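(* Let $\bar\psi:S^1\to S^1$ be a quasi-symmetric homeomorphism, let $\theta\in\mathbb R$, let $m:\mathbb H^2\to\mathbb H^2$ be the unique quasi-conformal minimal Lagrangian diffeomorphism with $\partial m=\bar\psi$, and let $b:T\mathbb H^2\to T\mathbb H^2$ be the associated bundle morphism. Let $g$ be the hyperbolic metric of $\mathbb H^2$, $\beta_\theta=\cos(\theta/2)E+\sin(\theta/2)Jb$, $g_\theta=g(\beta_\theta\cdot,\beta_\theta\cdot)$ and $g^\star_\theta=g(\beta_{\theta+\pi}\cdot,\beta_{\theta+\pi}\cdot)$. Then $g_\theta$ and $g^\star_\theta$ are complete hyperbolic metrics on $\mathbb H^2$, and the identity map from $(\mathbb H^2,g_\theta)$ to $(\mathbb H^2,g_\theta^\star)$ is minimal Lagrangian and quasi-conformal.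
   Context: $S^1=\partial_\infty\mathbb H^2$; $\partial m$ is the boundary extension of $m$. A diffeomorphism between hyperbolic surfaces $(\Sigma,g_1)\to(\Sigma',g_2)$ is minimal Lagrangian if it is area- and orientation-preserving and its graph is minimal in $(\Sigma\times\Sigma',g_1\oplus g_2)$. Existence and uniqueness of $m$ is a known theorem. The associated morphism $b$ is the unique bundle morphism of $T\mathbb H^2$ such that $m^*g=g(b\cdot,b\cdot)$, $\det b=1$, $b$ is positive-definite and self-adjoint for $g$, and $b$ satisfies the Codazzi equation $d^\nabla b=0$, i.e. $\nabla_u(bv)-\nabla_v(bu)-b[u,v]=0$ ($\nabla$ the Levi-Civita connection of $g$). $E$ is the identity of $T\mathbb H^2$ and $J$ the complex structure of $g$. *)

theory Defs
  imports "HOL-Analysis.Analysis"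
begin

section \<open>Smooth maps and diffeomorphisms of open sets\<close>

fun Ck_on :: "nat \<Rightarrow> 'a::real_normed_vector set \<Rightarrow> ('a \<Rightarrow> 'b::real_normed_vector) \<Rightarrow> bool" where
  "Ck_on 0 S f \<longleftrightarrow> continuous_on S f"
| "Ck_on (Suc k) S f \<longleftrightarrow> (\<forall>x\<in>S. f differentiable (at x)) \<and>
     (\<forall>v. Ck_on k S (\<lambda>x. frechet_derivative f (at x) v))"

definition smooth_on :: "'a::real_normed_vector set \<Rightarrow> ('a \<Rightarrow> 'b::real_normed_vector) \<Rightarrow> bool" where
  "smooth_on S f \<longleftrightarrow> (\<forall>k. Ck_on k S f)"

definition diffeo_on ::
    "'a::real_normed_vector set \<Rightarrow> 'b::real_normed_vector set \<Rightarrow> ('a \<Rightarrow> 'b) \<Rightarrow> bool" where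
  "diffeo_on S T f \<longleftrightarrow> bij_betw f S T \<and> smooth_on S f \<and> smooth_on T (inv_into S f)"


section \<open>Riemannian metrics on open sets of a Euclidean space\<close>

text \<open>
  A metric assigns to a point \<open>z\<close> a bilinear form \<open>g z\<close>; every tangent space of an open set of
  \<open>'a\<close> is identified with \<open>'a\<close>.
\<close>

type_synonym 'a metric_field = "'a \<Rightarrow> 'a \<Rightarrow> 'a \<Rightarrow> real"

definition riemannian_metric :: "'a::euclidean_space set \<Rightarrow> 'a metric_field \<Rightarrow> bool" where
  "riemannian_metric S g \<longleftrightarrow> open S \<and>
     (\<forall>z\<in>S. bilinear (g z) \<and> (\<forall>u v. g z u v = g z v u) \<and> (\<forall>u. u \<noteq> 0 \<longrightarrow> g z u u > 0)) \<and>
     (\<forall>u v. smooth_on S (\<lambda>z. g z u v))"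

definition pullback_metric ::
    "('a::real_normed_vector \<Rightarrow> 'b::real_normed_vector) \<Rightarrow> 'b metric_field \<Rightarrow> 'a metric_field" where
  "pullback_metric f g z u v =
     g (f z) (frechet_derivative f (at z) u) (frechet_derivative f (at z) v)"

definition product_metric :: "'a metric_field \<Rightarrow> 'b metric_field \<Rightarrow> ('a \<times> 'b) metric_field" where
  "product_metric g1 g2 p u v =
     g1 (fst p) (fst u) (fst v) + g2 (snd p) (snd u) (snd v)"

text \<open>
  The Christoffel map \<open>\<Gamma>\<^sub>z(u,v)\<close> is the Levi-Civita derivative at \<open>z\<close> of the constant field \<open>v\<close>
  in direction \<open>u\<close>; it is given by the Koszul formula, in which the bracket terms vanish for
  constant fields.
\<close>

definition christoffel :: "'a::real_normed_vector metric_field \<Rightarrow> 'a \<Rightarrow> 'a \<Rightarrow> 'a \<Rightarrow> 'a" where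
  "christoffel g z u v = (THE x. \<forall>w. 2 * g z x w =
      frechet_derivative (\<lambda>y. g y v w) (at z) u
    + frechet_derivative (\<lambda>y. g y u w) (at z) v
    - frechet_derivative (\<lambda>y. g y u v) (at z) w)"

definition covariant_derivative ::
    "'a::real_normed_vector metric_field \<Rightarrow> ('a \<Rightarrow> 'a) \<Rightarrow> ('a \<Rightarrow> 'a) \<Rightarrow> 'a \<Rightarrow> 'a" where
  "covariant_derivative g X Y z =
     frechet_derivative Y (at z) (X z) + christoffel g z (X z) (Y z)"

definition lie_bracket ::
    "('a::real_normed_vector \<Rightarrow> 'a) \<Rightarrow> ('a \<Rightarrow> 'a) \<Rightarrow> 'a \<Rightarrow> 'a" where
  "lie_bracket X Y z = frechet_derivative Y (at z) (X z) - frechet_derivative X (at z) (Y z)"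

definition riemann_curvature ::
    "'a::real_normed_vector metric_field \<Rightarrow> ('a \<Rightarrow> 'a) \<Rightarrow> ('a \<Rightarrow> 'a) \<Rightarrow> ('a \<Rightarrow> 'a) \<Rightarrow> 'a \<Rightarrow> 'a" where
  "riemann_curvature g X Y Z z =
      covariant_derivative g X (covariant_derivative g Y Z) z
    - covariant_derivative g Y (covariant_derivative g X Z) z
    - covariant_derivative g (lie_bracket X Y) Z z"

definition gauss_curvature :: "complex metric_field \<Rightarrow> complex \<Rightarrow> real" where
  "gauss_curvature g z =
     g z (riemann_curvature g (\<lambda>_. 1) (\<lambda>_. \<i>) (\<lambda>_. \<i>) z) 1 /
     (g z 1 1 * g z \<i> \<i> - (g z 1 \<i>)\<^sup>2)"

definition hyperbolic_metric :: "complex set \<Rightarrow> complex metric_field \<Rightarrow> bool" where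
  "hyperbolic_metric S g \<longleftrightarrow> riemannian_metric S g \<and> (\<forall>z\<in>S. gauss_curvature g z = -1)"

definition riemannian_speed ::
    "'a::real_normed_vector metric_field \<Rightarrow> (real \<Rightarrow> 'a) \<Rightarrow> real \<Rightarrow> real" where
  "riemannian_speed g \<gamma> t =
     sqrt (g (\<gamma> t) (vector_derivative \<gamma> (at t)) (vector_derivative \<gamma> (at t)))"

text \<open>
  A \<open>valid_path\<close> may have unbounded derivative near its finitely many exceptional points, so its
  length can be infinite; \<open>integral\<close> would then return 0. Such paths are excluded by the
  integrability condition. The value 0 off \<open>S\<close> is a convention: \<open>Metric_space S d\<close> requires
  \<open>d \<ge> 0\<close> also outside \<open>S\<close>.
\<close>

definition riemannian_dist ::
    "'a::real_normed_vector set \<Rightarrow> 'a metric_field \<Rightarrow> 'a \<Rightarrow> 'a \<Rightarrow> real" where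
  "riemannian_dist S g x y =
     (if x \<in> S \<and> y \<in> S then
        Inf {integral {0..1} (riemannian_speed g \<gamma>) | \<gamma>.
          valid_path \<gamma> \<and> path_image \<gamma> \<subseteq> S \<and> pathstart \<gamma> = x \<and> pathfinish \<gamma> = y \<and>
          riemannian_speed g \<gamma> integrable_on {0..1}}
      else 0)"

definition complete_metric :: "'a::real_normed_vector set \<Rightarrow> 'a metric_field \<Rightarrow> bool" where
  "complete_metric S g \<longleftrightarrow>
     Metric_space S (riemannian_dist S g) \<and> Metric_space.mcomplete S (riemannian_dist S g)"


section \<open>Minimal immersions of surfaces\<close>

definition normal_part ::
    "'b::real_normed_vector metric_field \<Rightarrow> ('a::real_normed_vector \<Rightarrow> 'b) \<Rightarrow> 'a \<Rightarrow> 'b \<Rightarrow> 'b" where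
  "normal_part G F z X =
     (THE n. (\<forall>w. G (F z) n (frechet_derivative F (at z) w) = 0) \<and>
             X - n \<in> range (frechet_derivative F (at z)))"

text \<open>
  The normal part of the Levi-Civita derivative, in direction \<open>dF(u)\<close>, of the field \<open>dF(v)\<close> along
  the immersion \<open>F\<close>, where \<open>v\<close> is a constant field on the domain.
\<close>

definition second_fundamental_form ::
    "'b::real_normed_vector metric_field \<Rightarrow> ('a::real_normed_vector \<Rightarrow> 'b) \<Rightarrow> 'a \<Rightarrow> 'a \<Rightarrow> 'a \<Rightarrow> 'b" where
  "second_fundamental_form G F z u v = normal_part G F z
     (frechet_derivative (\<lambda>y. frechet_derivative F (at y) v) (at z) u +
      christoffel G (F z) (frechet_derivative F (at z) u) (frechet_derivative F (at z) v))"

text \<open>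
  Vanishing of the mean curvature vector, the trace of the second fundamental form with respect
  to the induced metric.
\<close>

definition minimal_immersion ::
    "complex set \<Rightarrow> 'b::real_normed_vector metric_field \<Rightarrow> (complex \<Rightarrow> 'b) \<Rightarrow> bool" where
  "minimal_immersion S G F \<longleftrightarrow> smooth_on S F \<and>
     (\<forall>z\<in>S. inj (frechet_derivative F (at z)) \<and>
       (\<forall>e1 e2. pullback_metric F G z e1 e1 = 1 \<and> pullback_metric F G z e2 e2 = 1 \<and>
                pullback_metric F G z e1 e2 = 0 \<longrightarrow>
          second_fundamental_form G F z e1 e1 + second_fundamental_form G F z e2 e2 = 0))"


section \<open>Minimal Lagrangian and quasi-conformal diffeomorphisms\<close>

text \<open>The area form for the standard orientation of the plane; \<open>Im (cnj u * v)\<close> is the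
  determinant of the pair \<open>(u, v)\<close>.\<close>

definition area_form :: "complex metric_field \<Rightarrow> complex \<Rightarrow> complex \<Rightarrow> complex \<Rightarrow> real" where
  "area_form g z u v = sqrt (g z 1 1 * g z \<i> \<i> - (g z 1 \<i>)\<^sup>2) * Im (cnj u * v)"

text \<open>Pulling back one oriented area form to the other expresses preservation of both area and
  orientation.\<close>

definition area_orientation_preserving ::
    "complex set \<Rightarrow> complex metric_field \<Rightarrow> complex metric_field \<Rightarrow> (complex \<Rightarrow> complex) \<Rightarrow> bool" where
  "area_orientation_preserving S g1 g2 f \<longleftrightarrow>
     (\<forall>z\<in>S. \<forall>u v. area_form g2 (f z) (frechet_derivative f (at z) u) (frechet_derivative f (at z) v)
                  = area_form g1 z u v)"

definition minimal_lagrangian ::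
    "complex set \<Rightarrow> complex metric_field \<Rightarrow> complex set \<Rightarrow> complex metric_field \<Rightarrow>
     (complex \<Rightarrow> complex) \<Rightarrow> bool" where
  "minimal_lagrangian S g1 T g2 f \<longleftrightarrow> diffeo_on S T f \<and>
     area_orientation_preserving S g1 g2 f \<and>
     minimal_immersion S (product_metric g1 g2) (\<lambda>z. (z, f z))"

text \<open>For a diffeomorphism: the differentials send unit circles to ellipses whose eccentricity is
  bounded by a constant \<open>K\<close>.\<close>

definition quasi_conformal ::
    "complex set \<Rightarrow> complex metric_field \<Rightarrow> complex metric_field \<Rightarrow> (complex \<Rightarrow> complex) \<Rightarrow> bool" where
  "quasi_conformal S g1 g2 f \<longleftrightarrow>
     (\<exists>K\<ge>1. \<forall>z\<in>S. \<forall>u v. g1 z u u = 1 \<and> g1 z v v = 1 \<longrightarrow>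
        sqrt (pullback_metric f g2 z u u) \<le> K * sqrt (pullback_metric f g2 z v v))"


section \<open>The hyperbolic plane and its circle at infinity\<close>

text \<open>The Poincare disc model; its boundary at infinity is the unit circle.\<close>

abbreviation hyp_plane :: "complex set" where
  "hyp_plane \<equiv> ball 0 1"

abbreviation hyp_circle :: "complex set" where
  "hyp_circle \<equiv> sphere 0 1"

definition hyp_metric :: "complex metric_field" where
  "hyp_metric z u v = 4 * (u \<bullet> v) / (1 - (norm z)\<^sup>2)\<^sup>2"

definition boundary_extension :: "(complex \<Rightarrow> complex) \<Rightarrow> (complex \<Rightarrow> complex) \<Rightarrow> bool" where
  "boundary_extension m \<psi> \<longleftrightarrow>
     continuous_on (cball 0 1) (\<lambda>z. if z \<in> hyp_plane then m z else \<psi> z)"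

text \<open>
  The Ahlfors--Beurling condition on the circle: two points \<open>a\<close>, \<open>b\<close> at the same distance from
  \<open>x\<close> are the endpoints of two adjacent arcs of equal length.
\<close>

definition quasi_symmetric_homeo :: "(complex \<Rightarrow> complex) \<Rightarrow> bool" where
  "quasi_symmetric_homeo \<psi> \<longleftrightarrow>
     (\<exists>\<phi>. homeomorphism hyp_circle hyp_circle \<psi> \<phi>) \<and>
     (\<exists>M\<ge>1. \<forall>x\<in>hyp_circle. \<forall>a\<in>hyp_circle. \<forall>b\<in>hyp_circle.
        dist x a = dist x b \<longrightarrow> dist (\<psi> x) (\<psi> a) \<le> M * dist (\<psi> x) (\<psi> b))"


section \<open>The bundle morphism of a minimal Lagrangian map and the twisted metrics\<close>

definition plane_det :: "(complex \<Rightarrow> complex) \<Rightarrow> real" where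
  "plane_det L = Im (cnj (L 1) * L \<i>)"

definition codazzi :: "complex set \<Rightarrow> complex metric_field \<Rightarrow> (complex \<Rightarrow> complex \<Rightarrow> complex) \<Rightarrow> bool" where
  "codazzi S g b \<longleftrightarrow>
     (\<forall>X Y. smooth_on S X \<longrightarrow> smooth_on S Y \<longrightarrow> (\<forall>z\<in>S.
        covariant_derivative g X (\<lambda>y. b y (Y y)) z
      - covariant_derivative g Y (\<lambda>y. b y (X y)) z
      - b z (lie_bracket X Y z) = 0))"

definition associated_morphism ::
    "(complex \<Rightarrow> complex) \<Rightarrow> (complex \<Rightarrow> complex \<Rightarrow> complex) \<Rightarrow> bool" where
  "associated_morphism m b \<longleftrightarrow>
     (\<forall>z\<in>hyp_plane. linear (b z)) \<and> (\<forall>v. smooth_on hyp_plane (\<lambda>z. b z v)) \<and>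
     (\<forall>z\<in>hyp_plane.
        (\<forall>u v. pullback_metric m hyp_metric z u v = hyp_metric z (b z u) (b z v)) \<and>
        plane_det (b z) = 1 \<and>
        (\<forall>u. u \<noteq> 0 \<longrightarrow> hyp_metric z (b z u) u > 0) \<and>
        (\<forall>u v. hyp_metric z (b z u) v = hyp_metric z u (b z v))) \<and>
     codazzi hyp_plane hyp_metric b"

text \<open>The hyperbolic metric is conformal to the Euclidean one, so its complex structure \<open>J\<close> is
  multiplication by \<open>\<i>\<close>.\<close>

definition beta :: "(complex \<Rightarrow> complex \<Rightarrow> complex) \<Rightarrow> real \<Rightarrow> complex \<Rightarrow> complex \<Rightarrow> complex" where
  "beta b \<theta> z v = cos (\<theta> / 2) *\<^sub>R v + sin (\<theta> / 2) *\<^sub>R (\<i> * b z v)"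

definition twisted_metric :: "(complex \<Rightarrow> complex \<Rightarrow> complex) \<Rightarrow> real \<Rightarrow> complex metric_field" where
  "twisted_metric b \<theta> z u v = hyp_metric z (beta b \<theta> z u) (beta b \<theta> z v)"

end

theory Submission
  imports Defs
begin

text \<open>
  The connection \<open>\<nabla>\<close> of the hyperbolic metric \<open>g\<close> commutes with \<open>J\<close>, and \<open>b\<close> is symmetric with
  determinant one, so \<open>\<beta>\<^sub>\<theta>\<close> is again a Codazzi field of determinant one. For such a field \<open>B\<close> the
  Levi-Civita connection of \<open>g(B\<cdot>,B\<cdot>)\<close> is \<open>B\<inverse>\<nabla>B\<close>, which makes the curvature that of \<open>g\<close>
  divided by \<open>det B\<close>. Since \<open>m\<close> is quasi-conformal, \<open>b\<close> is bounded, hence \<open>\<beta>\<^sub>\<theta>\<close> and its inverse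
  are bounded; this gives completeness and quasi-conformality. Finally
  \<open>g\<^sub>\<theta> + g\<^sub>\<theta>\<^sub>+\<^sub>\<pi> = g + g(b\<cdot>,b\<cdot>) = tr(b) g(b\<cdot>,\<cdot>)\<close> does not depend on \<open>\<theta>\<close>, and the trace of
  \<open>\<nabla>b\<close> with respect to it is a multiple of \<open>d ln (det b) = 0\<close>. So the connections of \<open>g\<^sub>\<theta>\<close>,
  \<open>g\<close> and \<open>g\<^sub>\<theta>\<^sub>+\<^sub>\<pi>\<close> have the same trace, which is the minimality of the diagonal.
\<close>

section \<open>Calculus of smooth maps\<close>

text \<open>The obstacle is that connection and curvature rest on definite descriptions and on
  \<open>frechet_derivative\<close>. Every Christoffel map is therefore guessed and checked against
  the Koszul formula, which has at most one solution. The guess \<open>B\<inverse>\<nabla>B\<close>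
  is metric because \<open>B\<close> is an isometry onto \<open>g\<close>, and torsion-free by the
  Codazzi equation. With tangent vectors as complex numbers, \<open>\<nabla>\<close> is a derivative
  plus multiplication by a complex coefficient, so its curvature is one scalar identity without a
  quadratic term. Bounds on inverses come almost for free: in dimension two with determinant one,
  the inverse has the entries of the map up to order and sign. For minimality, the diagonal has
  constant differential, so its second fundamental form is the normal part of the pair of
  Christoffel maps. It is traced with the metric induced on the diagonal, which is
  \<open>g\<^sub>\<theta> + g\<^sub>\<theta>\<^sub>+\<^sub>\<pi>\<close>; hence the role of that
  sum.\<close>

lemma Ck_on_cong:
  assumes "open S" "\<And>x. x \<in> S \<Longrightarrow> f x = g x" "Ck_on k S f"
  shows "Ck_on k S g"
  using assms(2,3)
proof (induction k arbitrary: f g)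
  case 0
  then show ?case by (simp cong: continuous_on_cong)
next
  case (Suc k)
  have fd: "frechet_derivative f (at x) = frechet_derivative g (at x)" if "x \<in> S" for x
    using frechet_derivative_transform_within_open[of f x S g] that Suc.prems \<open>open S\<close> by auto
  have "g differentiable (at x)" if "x \<in> S" for x
  proof -
    have "(f has_derivative frechet_derivative f (at x)) (at x)"
      using Suc.prems(2) that frechet_derivative_works by auto
    then have "(g has_derivative frechet_derivative f (at x)) (at x)"
      using has_derivative_transform_within_open \<open>open S\<close> that Suc.prems(1) by blast
    then show ?thesis by (auto simp: differentiable_def)
  qed
  moreover have "Ck_on k S (\<lambda>x. frechet_derivative g (at x) v)" for v
    by (rule Suc.IH[of "\<lambda>x. frechet_derivative f (at x) v"]) (use fd Suc.prems in auto)
  ultimately show ?case by auto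
qed

text \<open>Derivatives are unique, so an explicit formula may replace
  \<open>frechet_derivative\<close>. The closure rules for sums, products and inverses are
  inductions through this rule.\<close>

lemma Ck_on_SucI:
  assumes "open S"
    and "\<And>x. x \<in> S \<Longrightarrow> (f has_derivative f' x) (at x)"
    and "\<And>v. Ck_on k S (\<lambda>x. f' x v)"
  shows "Ck_on (Suc k) S f"
proof -
  have eq: "f' x = frechet_derivative f (at x)" if "x \<in> S" for x
    using assms(2)[OF that] by (rule frechet_derivative_at)
  have "Ck_on k S (\<lambda>x. frechet_derivative f (at x) v)" for v
    by (rule Ck_on_cong[OF assms(1) _ assms(3)[of v]]) (simp add: eq)
  moreover have "\<forall>x\<in>S. f differentiable (at x)"
    using assms(2) by (auto simp: differentiable_def)
  ultimately show ?thesis by simp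
qed

lemma Ck_on_SucD: "Ck_on (Suc k) S f \<Longrightarrow> Ck_on k S f"
proof (induction k arbitrary: f)
  case 0
  then show ?case
    by (auto intro!: continuous_at_imp_continuous_on differentiable_imp_continuous_within)
next
  case (Suc k)
  then show ?case by (metis Ck_on.simps(2))
qed

lemma Ck_on_has_derivative:
  "Ck_on (Suc k) S f \<Longrightarrow> x \<in> S \<Longrightarrow> (f has_derivative frechet_derivative f (at x)) (at x)"
  using frechet_derivative_works by auto

lemma Ck_on_const: "Ck_on k S (\<lambda>_. c)"
  by (induction k arbitrary: c) auto

lemma Ck_on_bounded_linear:
  assumes "bounded_linear h" "open S" "Ck_on k S f"
  shows "Ck_on k S (\<lambda>x. h (f x))"
  using assms(3)
proof (induction k arbitrary: f)
  case 0
  then show ?case using assms(1) by (auto intro: bounded_linear.continuous_on)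
next
  case (Suc k)
  show ?case
  proof (rule Ck_on_SucI[OF assms(2)])
    show "((\<lambda>x. h (f x)) has_derivative (\<lambda>v. h (frechet_derivative f (at x) v))) (at x)"
      if "x \<in> S" for x
      using Ck_on_has_derivative[OF Suc.prems that] assms(1)
      by (simp add: bounded_linear.has_derivative)
    show "Ck_on k S (\<lambda>x. h (frechet_derivative f (at x) v))" for v
      by (rule Suc.IH) (use Suc.prems in auto)
  qed
qed

lemma Ck_on_ident:
  assumes "open S"
  shows "Ck_on k S (\<lambda>x. x)"
proof (cases k)
  case (Suc j)
  then show ?thesis
    using Ck_on_SucI[OF assms, of "\<lambda>x. x" "\<lambda>_ v. v" j] Ck_on_const by auto
qed simp

lemma Ck_on_add:
  assumes "open S" "Ck_on k S f" "Ck_on k S g"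
  shows "Ck_on k S (\<lambda>x. f x + g x)"
  using assms(2,3)
proof (induction k arbitrary: f g)
  case 0
  then show ?case by (auto intro: continuous_intros)
next
  case (Suc k)
  show ?case
  proof (rule Ck_on_SucI[OF assms(1)])
    show "((\<lambda>x. f x + g x) has_derivative
        (\<lambda>v. frechet_derivative f (at x) v + frechet_derivative g (at x) v)) (at x)"
      if "x \<in> S" for x
      by (intro has_derivative_add Ck_on_has_derivative[OF Suc.prems(1) that]
          Ck_on_has_derivative[OF Suc.prems(2) that])
    show "Ck_on k S (\<lambda>x. frechet_derivative f (at x) v + frechet_derivative g (at x) v)" for v
      by (rule Suc.IH) (use Suc.prems in auto)
  qed
qed

lemma Ck_on_bounded_bilinear:
  assumes "bounded_bilinear bil" "open S" "Ck_on k S f" "Ck_on k S g"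
  shows "Ck_on k S (\<lambda>x. bil (f x) (g x))"
  using assms(3,4)
proof (induction k arbitrary: f g)
  case 0
  then show ?case using assms(1) by (auto intro: bounded_bilinear.continuous_on)
next
  case (Suc k)
  show ?case
  proof (rule Ck_on_SucI[OF assms(2)])
    show "((\<lambda>x. bil (f x) (g x)) has_derivative
        (\<lambda>v. bil (f x) (frechet_derivative g (at x) v) +
             bil (frechet_derivative f (at x) v) (g x))) (at x)"
      if "x \<in> S" for x
      by (intro bounded_bilinear.FDERIV[OF assms(1)] Ck_on_has_derivative[OF Suc.prems(1) that]
          Ck_on_has_derivative[OF Suc.prems(2) that])
    \<comment> \<open>Each Leibniz term keeps one undifferentiated factor, which must be lowered by
      one order before the induction hypothesis applies.\<close>
    show "Ck_on k S (\<lambda>x. bil (f x) (frechet_derivative g (at x) v) +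
             bil (frechet_derivative f (at x) v) (g x))" for v
      by (intro Ck_on_add[OF assms(2)] Suc.IH)
         (use Suc.prems Suc.prems[THEN Ck_on_SucD] in auto)
  qed
qed

lemmas Ck_on_mult = Ck_on_bounded_bilinear[OF bounded_bilinear_mult]

lemma Ck_on_inverse:
  fixes f :: "'a::real_normed_vector \<Rightarrow> real"
  assumes "open S" "\<And>x. x \<in> S \<Longrightarrow> f x \<noteq> 0" "Ck_on k S f"
  shows "Ck_on k S (\<lambda>x. inverse (f x))"
  using assms(3)
proof (induction k)
  case 0
  then show ?case using assms(2) by (auto intro!: continuous_intros)
next
  case (Suc k)
  show ?case
  proof (rule Ck_on_SucI[OF assms(1)])
    show "((\<lambda>x. inverse (f x)) has_derivative
        (\<lambda>v. - (inverse (f x) * frechet_derivative f (at x) v * inverse (f x)))) (at x)"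
      if "x \<in> S" for x
      by (rule Deriv.has_derivative_inverse[OF assms(2)[OF that] Ck_on_has_derivative[OF Suc.prems that]])
    have "Ck_on k S (\<lambda>x. inverse (f x))" using Suc Ck_on_SucD by blast
    then have "Ck_on k S (\<lambda>x. (inverse (f x) * frechet_derivative f (at x) v) * inverse (f x))" for v
      by (intro Ck_on_mult[OF assms(1)]) (use Suc.prems in auto)
    then show "Ck_on k S (\<lambda>x. - (inverse (f x) * frechet_derivative f (at x) v * inverse (f x)))" for v
      by (rule Ck_on_bounded_linear[OF bounded_linear_minus[OF bounded_linear_ident] assms(1)])
  qed
qed

section \<open>Closure properties of smooth maps\<close>

lemma smooth_on_has_derivative:
  "smooth_on S f \<Longrightarrow> x \<in> S \<Longrightarrow> (f has_derivative frechet_derivative f (at x)) (at x)"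
  using Ck_on_has_derivative unfolding smooth_on_def by blast

lemma smooth_on_frechet_derivative:
  "smooth_on S f \<Longrightarrow> smooth_on S (\<lambda>x. frechet_derivative f (at x) v)"
  unfolding smooth_on_def by (metis Ck_on.simps(2))

lemma smooth_on_imp_continuous_on: "smooth_on S f \<Longrightarrow> continuous_on S f"
  unfolding smooth_on_def by (metis Ck_on.simps(1))

lemma smooth_on_cong:
  "open S \<Longrightarrow> (\<And>x. x \<in> S \<Longrightarrow> f x = g x) \<Longrightarrow> smooth_on S f \<Longrightarrow> smooth_on S g"
  unfolding smooth_on_def using Ck_on_cong by blast

lemma smooth_on_const: "smooth_on S (\<lambda>_. c)"
  by (simp add: smooth_on_def Ck_on_const)

lemma smooth_on_ident: "open S \<Longrightarrow> smooth_on S (\<lambda>x. x)"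
  by (simp add: smooth_on_def Ck_on_ident)

lemma smooth_on_bounded_linear:
  "bounded_linear h \<Longrightarrow> open S \<Longrightarrow> smooth_on S f \<Longrightarrow> smooth_on S (\<lambda>x. h (f x))"
  by (simp add: smooth_on_def Ck_on_bounded_linear)

lemma smooth_on_add:
  "open S \<Longrightarrow> smooth_on S f \<Longrightarrow> smooth_on S g \<Longrightarrow> smooth_on S (\<lambda>x. f x + g x)"
  by (simp add: smooth_on_def Ck_on_add)

lemma smooth_on_bounded_bilinear:
  "bounded_bilinear bil \<Longrightarrow> open S \<Longrightarrow> smooth_on S f \<Longrightarrow> smooth_on S g \<Longrightarrow>
    smooth_on S (\<lambda>x. bil (f x) (g x))"
  by (simp add: smooth_on_def Ck_on_bounded_bilinear)

lemma smooth_on_inverse: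
  fixes f :: "'a::real_normed_vector \<Rightarrow> real"
  shows "open S \<Longrightarrow> (\<And>x. x \<in> S \<Longrightarrow> f x \<noteq> 0) \<Longrightarrow> smooth_on S f \<Longrightarrow>
    smooth_on S (\<lambda>x. inverse (f x))"
  by (simp add: smooth_on_def Ck_on_inverse)

text \<open>The second difference \<open>f (z + hu + hv) - f (z + hu) - f (z + hv) + f z\<close> is symmetric in
  \<open>u\<close> and \<open>v\<close>; two applications of the mean value theorem turn it into a second derivative.\<close>

lemma second_difference_mvt:
  fixes f :: "'a::real_normed_vector \<Rightarrow> real"
  assumes f: "Ck_on (Suc (Suc k)) S f" and h: "h > 0"
    and S: "\<And>s t. 0 \<le> s \<Longrightarrow> s \<le> h \<Longrightarrow> 0 \<le> t \<Longrightarrow> t \<le> h \<Longrightarrow> z + s *\<^sub>R u + t *\<^sub>R v \<in> S"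
  obtains s t where "0 < s" "s < h" "0 < t" "t < h"
    "f (z + h *\<^sub>R u + h *\<^sub>R v) - f (z + h *\<^sub>R u) - f (z + h *\<^sub>R v) + f z =
      h\<^sup>2 * frechet_derivative (\<lambda>y. frechet_derivative f (at y) u) (at (z + s *\<^sub>R u + t *\<^sub>R v)) v"
proof -
  have lin: "frechet_derivative g (at y) (r *\<^sub>R w) = r * frechet_derivative g (at y) w"
    if "(g has_derivative frechet_derivative g (at y)) (at y)"
    for g :: "'a \<Rightarrow> real" and y w r
    using linear_cmul[OF has_derivative_linear[OF that]] by simp
  define F where "F = (\<lambda>s. f (z + s *\<^sub>R u + h *\<^sub>R v) - f (z + s *\<^sub>R u))"
  define F' where "F' = (\<lambda>s. frechet_derivative f (at (z + s *\<^sub>R u + h *\<^sub>R v)) u -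
      frechet_derivative f (at (z + s *\<^sub>R u)) u)"
  have F: "(F has_real_derivative F' s) (at s)" if s: "0 \<le> s" "s \<le> h" for s
  proof -
    have "(f has_derivative frechet_derivative f (at (z + s *\<^sub>R u + t *\<^sub>R v)))
        (at (z + s *\<^sub>R u + t *\<^sub>R v))" if "0 \<le> t" "t \<le> h" for t
      by (rule Ck_on_has_derivative[OF f]) (use S s that in auto)
    then have 1: "(f has_derivative frechet_derivative f (at (z + s *\<^sub>R u + h *\<^sub>R v)))
        (at (z + s *\<^sub>R u + h *\<^sub>R v))"
      and 2: "(f has_derivative frechet_derivative f (at (z + s *\<^sub>R u))) (at (z + s *\<^sub>R u))"
      using h by force+
    have "((\<lambda>s. z + s *\<^sub>R u + h *\<^sub>R v) has_derivative (\<lambda>r. r *\<^sub>R u)) (at s)"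
      by (auto intro!: derivative_eq_intros)
    from diff_chain_at[OF this 1]
    have a: "((\<lambda>s. f (z + s *\<^sub>R u + h *\<^sub>R v)) has_derivative
        (\<lambda>r. frechet_derivative f (at (z + s *\<^sub>R u + h *\<^sub>R v)) (r *\<^sub>R u))) (at s)"
      by (simp add: o_def)
    have "((\<lambda>s. z + s *\<^sub>R u) has_derivative (\<lambda>r. r *\<^sub>R u)) (at s)"
      by (auto intro!: derivative_eq_intros)
    from diff_chain_at[OF this 2]
    have b: "((\<lambda>s. f (z + s *\<^sub>R u)) has_derivative
        (\<lambda>r. frechet_derivative f (at (z + s *\<^sub>R u)) (r *\<^sub>R u))) (at s)"
      by (simp add: o_def)
    have "(F has_derivative (\<lambda>r. frechet_derivative f (at (z + s *\<^sub>R u + h *\<^sub>R v)) (r *\<^sub>R u) -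
       frechet_derivative f (at (z + s *\<^sub>R u)) (r *\<^sub>R u))) (at s)"
      unfolding F_def by (rule has_derivative_diff[OF a b])
    then show ?thesis
      unfolding has_field_derivative_def F'_def lin[OF 1] lin[OF 2]
      by (rule has_derivative_eq_rhs) (simp add: fun_eq_iff algebra_simps)
  qed
  obtain s where s: "0 < s" "s < h" "F h - F 0 = (h - 0) * F' s"
    using MVT2[OF h, of F F'] F by auto
  define G where "G = (\<lambda>t. frechet_derivative f (at (z + s *\<^sub>R u + t *\<^sub>R v)) u)"
  define G' where "G' = (\<lambda>t. frechet_derivative (\<lambda>y. frechet_derivative f (at y) u)
      (at (z + s *\<^sub>R u + t *\<^sub>R v)) v)"
  have G: "(G has_real_derivative G' t) (at t)" if t: "0 \<le> t" "t \<le> h" for t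
  proof -
    let ?f = "\<lambda>y. frechet_derivative f (at y) u"
    have "Ck_on (Suc k) S ?f" using f by simp
    then have 1: "(?f has_derivative frechet_derivative ?f (at (z + s *\<^sub>R u + t *\<^sub>R v)))
        (at (z + s *\<^sub>R u + t *\<^sub>R v))"
      by (rule Ck_on_has_derivative) (use S s t in auto)
    have "((\<lambda>t. z + s *\<^sub>R u + t *\<^sub>R v) has_derivative (\<lambda>r. r *\<^sub>R v)) (at t)"
      by (auto intro!: derivative_eq_intros)
    from diff_chain_at[OF this 1]
    have a: "(G has_derivative
        (\<lambda>r. frechet_derivative ?f (at (z + s *\<^sub>R u + t *\<^sub>R v)) (r *\<^sub>R v))) (at t)"
      by (simp add: o_def G_def)
    then show ?thesis
      unfolding has_field_derivative_def G'_def lin[OF 1]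
      by (rule has_derivative_eq_rhs) (simp add: fun_eq_iff algebra_simps)
  qed
  obtain t where t: "0 < t" "t < h" "G h - G 0 = (h - 0) * G' t"
    using MVT2[OF h, of G G'] G by auto
  have "F' s = G h - G 0" by (simp add: F'_def G_def)
  then have "F h - F 0 = h\<^sup>2 * G' t" using s t by (simp add: power2_eq_square)
  then show ?thesis using that[OF s(1,2) t(1,2)]
    by (simp add: F_def G'_def algebra_simps)
qed

lemma second_derivative_symmetric_real:
  fixes f :: "'a::real_normed_vector \<Rightarrow> real"
  assumes S: "open S" "z \<in> S" and f: "Ck_on (Suc (Suc 0)) S f"
  shows "frechet_derivative (\<lambda>y. frechet_derivative f (at y) u) (at z) v =
         frechet_derivative (\<lambda>y. frechet_derivative f (at y) v) (at z) u"
proof (rule ccontr)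
  define A where "A = (\<lambda>y. frechet_derivative (\<lambda>y. frechet_derivative f (at y) u) (at y) v)"
  define B where "B = (\<lambda>y. frechet_derivative (\<lambda>y. frechet_derivative f (at y) v) (at y) u)"
  assume "\<not> ?thesis"
  then have ne: "A z \<noteq> B z" by (simp add: A_def B_def)
  \<comment> \<open>Half the gap: a common value within \<open>e\<close> of both \<open>A z\<close>
    and \<open>B z\<close> would make their distance less than \<open>2 * e\<close>, which it
    equals.\<close>
  define e where "e = \<bar>A z - B z\<bar> / 2"
  have e: "e > 0" using ne by (simp add: e_def)
  have "continuous_on S A" "continuous_on S B" using f by (auto simp: A_def B_def)
  then have "isCont A z" "isCont B z" using S by (simp_all add: continuous_on_eq_continuous_at)
  then obtain d1 d2 where d: "d1 > 0" "\<And>y. dist y z < d1 \<Longrightarrow> dist (A y) (A z) < e"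
      "d2 > 0" "\<And>y. dist y z < d2 \<Longrightarrow> dist (B y) (B z) < e"
    using e unfolding continuous_at_eps_delta by metis
  obtain d3 where d3: "d3 > 0" "ball z d3 \<subseteq> S" using S openE by blast
  define d where "d = min d1 (min d2 d3)"
  \<comment> \<open>With this side length the whole parallelogram spanned at \<open>z\<close> stays
    within \<open>d / 2\<close> of \<open>z\<close>; the summand 1 keeps the denominator positive
    when both vectors vanish.\<close>
  define h where "h = d / (2 * (1 + norm u + norm v))"
  have dpos: "d > 0" using d d3 by (simp add: d_def)
  have pos: "0 < 1 + norm u + norm v" by (smt (verit) norm_ge_zero)
  have h: "h > 0" using dpos pos by (simp add: h_def)
  have near: "dist (z + s *\<^sub>R u' + t *\<^sub>R v') z < d"
    if st: "0 \<le> s" "s \<le> h" "0 \<le> t" "t \<le> h" and uv: "u' = u \<and> v' = v \<or> u' = v \<and> v' = u" for s t u' v'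
  proof -
    have "dist (z + s *\<^sub>R u' + t *\<^sub>R v') z = norm (s *\<^sub>R u' + t *\<^sub>R v')"
      by (simp add: dist_norm algebra_simps)
    also have "\<dots> \<le> s * norm u' + t * norm v'"
      using norm_triangle_ineq[of "s *\<^sub>R u'" "t *\<^sub>R v'"] st by simp
    also have "\<dots> \<le> h * norm u' + h * norm v'"
      using st by (intro add_mono mult_right_mono) auto
    also have "\<dots> = h * (norm u + norm v)" using uv by (auto simp: algebra_simps)
    also have "\<dots> < h * (1 + norm u + norm v)" using h by simp
    also have "\<dots> = d / 2" using pos by (simp add: h_def field_simps)
    also have "\<dots> < d" using dpos by simp
    finally show ?thesis .
  qed
  have inS: "z + s *\<^sub>R u' + t *\<^sub>R v' \<in> S"
    if "0 \<le> s" "s \<le> h" "0 \<le> t" "t \<le> h" "u' = u \<and> v' = v \<or> u' = v \<and> v' = u" for s t u' v'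
    using near[OF that] d3(2) by (auto simp: d_def dist_commute)
  obtain s t where 1: "0 < s" "s < h" "0 < t" "t < h"
    "f (z + h *\<^sub>R u + h *\<^sub>R v) - f (z + h *\<^sub>R u) - f (z + h *\<^sub>R v) + f z = h\<^sup>2 * A (z + s *\<^sub>R u + t *\<^sub>R v)"
    using second_difference_mvt[OF f h, of z u v] inS unfolding A_def by blast
  obtain s' t' where 2: "0 < s'" "s' < h" "0 < t'" "t' < h"
    "f (z + h *\<^sub>R v + h *\<^sub>R u) - f (z + h *\<^sub>R v) - f (z + h *\<^sub>R u) + f z = h\<^sup>2 * B (z + s' *\<^sub>R v + t' *\<^sub>R u)"
    using second_difference_mvt[OF f h, of z v u] inS unfolding B_def by blast
  have "h\<^sup>2 * A (z + s *\<^sub>R u + t *\<^sub>R v) = h\<^sup>2 * B (z + s' *\<^sub>R v + t' *\<^sub>R u)"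
    using 1(5) 2(5) by (simp add: algebra_simps)
  then have "A (z + s *\<^sub>R u + t *\<^sub>R v) = B (z + s' *\<^sub>R v + t' *\<^sub>R u)" using h by simp
  moreover have "dist (A (z + s *\<^sub>R u + t *\<^sub>R v)) (A z) < e"
    using near[of s t u v] 1 by (intro d) (simp add: d_def)
  moreover have "dist (B (z + s' *\<^sub>R v + t' *\<^sub>R u)) (B z) < e"
    using near[of s' t' v u] 2 by (intro d) (simp add: d_def)
  ultimately show False unfolding e_def dist_real_def by (auto simp: abs_if split: if_splits)
qed

text \<open>Inner products with basis vectors reduce this to the real case. It later cancels the
  second derivatives of \<open>B\<close> in the curvature.\<close>

lemma second_derivative_symmetric:
  fixes f :: "'a::real_normed_vector \<Rightarrow> 'b::euclidean_space"
  assumes S: "open S" "z \<in> S" and f: "smooth_on S f"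
  shows "frechet_derivative (\<lambda>y. frechet_derivative f (at y) u) (at z) v =
         frechet_derivative (\<lambda>y. frechet_derivative f (at y) v) (at z) u"
proof (rule euclidean_eqI)
  fix w :: 'b
  have fd: "frechet_derivative (\<lambda>y. g y \<bullet> w) (at x) = (\<lambda>v. frechet_derivative g (at x) v \<bullet> w)"
    if "smooth_on S g" "x \<in> S" for g :: "'a \<Rightarrow> 'b" and x
    by (rule frechet_derivative_at[symmetric])
       (intro has_derivative_inner_left smooth_on_has_derivative[OF that])
  have comp: "frechet_derivative (\<lambda>y. frechet_derivative (\<lambda>y. f y \<bullet> w) (at y) u) (at z) v =
      frechet_derivative (\<lambda>y. frechet_derivative f (at y) u) (at z) v \<bullet> w" for u v
  proof -
    have sm: "smooth_on S (\<lambda>y. frechet_derivative f (at y) u)"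
      by (rule smooth_on_frechet_derivative[OF f])
    have "(\<lambda>y. frechet_derivative f (at y) u \<bullet> w) differentiable at z"
      using has_derivative_inner_left[OF smooth_on_has_derivative[OF sm S(2)]]
      by (auto simp: differentiable_def)
    then have "frechet_derivative (\<lambda>y. frechet_derivative f (at y) u \<bullet> w) (at z) =
        frechet_derivative (\<lambda>y. frechet_derivative (\<lambda>y. f y \<bullet> w) (at y) u) (at z)"
      by (rule frechet_derivative_transform_within_open[OF _ S]) (simp add: fd[OF f])
    from this[symmetric] show ?thesis by (simp only: fd[OF sm S(2)])
  qed
  have "Ck_on (Suc (Suc 0)) S (\<lambda>y. f y \<bullet> w)"
    using smooth_on_bounded_linear[OF bounded_linear_inner_left S(1) f, of w]
    unfolding smooth_on_def by blast
  from second_derivative_symmetric_real[OF S this, of u v]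
  show "frechet_derivative (\<lambda>y. frechet_derivative f (at y) u) (at z) v \<bullet> w =
        frechet_derivative (\<lambda>y. frechet_derivative f (at y) v) (at z) u \<bullet> w"
    by (simp add: comp)
qed

section \<open>The hyperbolic metric of the disc\<close>

text \<open>This is the square of the conformal length scale, so norms of vectors change by its
  square root; it is also the area density.\<close>

definition hyp_factor :: "complex \<Rightarrow> real" where
  "hyp_factor z = 4 / (1 - (norm z)\<^sup>2)\<^sup>2"

text \<open>The Levi-Civita connection of \<open>\<lambda>\<^sup>2|dz|\<^sup>2\<close> is \<open>\<nabla>\<^sub>u Y = dY(u) + 2(\<partial>\<^sub>z ln \<lambda>) u Y\<close>; the
  coefficient is complex, so the complex structure is parallel.\<close>

definition hyp_coeff :: "complex \<Rightarrow> complex" where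
  "hyp_coeff z = 2 * cnj z / of_real (1 - (norm z)\<^sup>2)"

text \<open>Kept independent of \<open>christoffel\<close>, so that calculations with it involve no
  definite description; \<open>covariant_derivative_hyp_metric\<close> identifies the two
  afterwards.\<close>

definition hyp_cov :: "(complex \<Rightarrow> complex) \<Rightarrow> complex \<Rightarrow> complex \<Rightarrow> complex" where
  "hyp_cov Y z u = frechet_derivative Y (at z) u + hyp_coeff z * u * Y z"

lemma hyp_metric_eq: "hyp_metric z u v = hyp_factor z * (u \<bullet> v)"
  by (simp add: hyp_metric_def hyp_factor_def)

lemma hyp_metric_commute: "hyp_metric z u v = hyp_metric z v u"
  by (simp add: hyp_metric_eq inner_commute)

lemma sqrt_hyp_metric: "sqrt (hyp_metric z u u) = sqrt (hyp_factor z) * norm u"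
  by (simp add: hyp_metric_eq real_sqrt_mult norm_eq_sqrt_inner)

lemma disc_pos: "z \<in> ball 0 1 \<Longrightarrow> 0 < 1 - (norm (z::complex))\<^sup>2"
  by (simp add: abs_square_less_1)

lemma hyp_factor_pos: "z \<in> hyp_plane \<Longrightarrow> 0 < hyp_factor z"
  using disc_pos[of z] by (simp add: hyp_factor_def)

lemma hyp_factor_smooth: "smooth_on hyp_plane hyp_factor"
proof -
  have "smooth_on hyp_plane (\<lambda>z::complex. 1 + - (z \<bullet> z))"
    by (intro smooth_on_add smooth_on_const open_ball smooth_on_ident
        smooth_on_bounded_bilinear[OF bounded_bilinear_inner]
        smooth_on_bounded_linear[OF bounded_linear_minus[OF bounded_linear_ident]])
  then have "smooth_on hyp_plane (\<lambda>z::complex. inverse (1 + - (z \<bullet> z)))"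
    by (rule smooth_on_inverse[OF open_ball, rotated])
       (use disc_pos in \<open>force simp: power2_norm_eq_inner\<close>)
  then have "smooth_on hyp_plane
      (\<lambda>z::complex. 4 * (inverse (1 + - (z \<bullet> z)) * inverse (1 + - (z \<bullet> z))))"
    by (intro smooth_on_const open_ball smooth_on_bounded_bilinear[OF bounded_bilinear_mult])
  then show ?thesis
    by (rule smooth_on_cong[OF open_ball, rotated])
       (simp add: hyp_factor_def power2_norm_eq_inner divide_inverse power_inverse flip: power2_eq_square)
qed

lemma one_minus_norm_has_derivative:
  "((\<lambda>z::complex. 1 - (norm z)\<^sup>2) has_derivative (\<lambda>u. - 2 * (z \<bullet> u))) (at z)"
proof -
  have "((\<lambda>z::complex. 1 - z \<bullet> z) has_derivative (\<lambda>u. - 2 * (z \<bullet> u))) (at z)"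
    by (rule has_derivative_eq_rhs, (rule derivative_intros)+) (simp add: fun_eq_iff inner_commute)
  then show ?thesis by (simp add: power2_norm_eq_inner)
qed

lemma inverse_one_minus_norm_has_derivative:
  assumes "z \<in> hyp_plane"
  shows "((\<lambda>z. inverse (1 - (norm z)\<^sup>2)) has_derivative
    (\<lambda>u. 2 * (z \<bullet> u) * (inverse (1 - (norm z)\<^sup>2))\<^sup>2)) (at z)"
proof -
  from Deriv.has_derivative_inverse[OF _ one_minus_norm_has_derivative, of z] disc_pos[OF assms]
  show ?thesis by (simp add: power2_eq_square algebra_simps)
qed

lemma hyp_factor_has_derivative:
  assumes "z \<in> hyp_plane"
  shows "(hyp_factor has_derivative (\<lambda>u. 2 * Re (hyp_coeff z * u) * hyp_factor z)) (at z)"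
proof -
  let ?r = "1 - (norm z)\<^sup>2"
  have "((\<lambda>z. 4 * (inverse (1 - (norm z)\<^sup>2) * inverse (1 - (norm z)\<^sup>2))) has_derivative
      (\<lambda>u. 4 * (inverse ?r * (2 * (z \<bullet> u) * (inverse ?r)\<^sup>2) +
        2 * (z \<bullet> u) * (inverse ?r)\<^sup>2 * inverse ?r))) (at z)"
    by (intro has_derivative_mult_right has_derivative_mult
        inverse_one_minus_norm_has_derivative[OF assms])
  moreover have "(\<lambda>u. 4 * (inverse ?r * (2 * (z \<bullet> u) * (inverse ?r)\<^sup>2) +
        2 * (z \<bullet> u) * (inverse ?r)\<^sup>2 * inverse ?r)) =
      (\<lambda>u. 2 * Re (hyp_coeff z * u) * hyp_factor z)"
  proof
    fix u
    have "hyp_coeff z * u = of_real (2 * inverse ?r) * (cnj z * u)"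
      by (simp add: hyp_coeff_def divide_inverse)
    moreover have "Re (cnj z * u) = z \<bullet> u" by (simp add: inner_complex_def)
    ultimately have "Re (hyp_coeff z * u) = 2 * inverse ?r * (z \<bullet> u)"
      by (simp only: Re_complex_of_real times_complex.sel Im_complex_of_real)
    then show "4 * (inverse ?r * (2 * (z \<bullet> u) * (inverse ?r)\<^sup>2) +
        2 * (z \<bullet> u) * (inverse ?r)\<^sup>2 * inverse ?r) = 2 * Re (hyp_coeff z * u) * hyp_factor z"
      by (simp add: hyp_factor_def divide_inverse power_inverse)
  qed
  moreover have "(\<lambda>z. 4 * (inverse (1 - (norm z)\<^sup>2) * inverse (1 - (norm z)\<^sup>2))) = hyp_factor"
    by (simp add: fun_eq_iff hyp_factor_def divide_inverse power_inverse flip: power2_eq_square)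
  ultimately show ?thesis by simp
qed

text \<open>Metric compatibility of \<open>hyp_cov\<close>. The real part of
  \<open>hyp_coeff z * u\<close> accounts for the derivative of the conformal factor; the imaginary
  part acts as a skew rotation and cancels between the two terms.\<close>

lemma hyp_metric_has_derivative:
  assumes z: "z \<in> hyp_plane"
    and V: "(V has_derivative V') (at z)" and W: "(W has_derivative W') (at z)"
  shows "((\<lambda>y. hyp_metric y (V y) (W y)) has_derivative
    (\<lambda>u. hyp_metric z (V' u + hyp_coeff z * u * V z) (W z) +
         hyp_metric z (V z) (W' u + hyp_coeff z * u * W z))) (at z)"
  unfolding hyp_metric_eq
  by (rule has_derivative_eq_rhs)
     (rule has_derivative_mult[OF hyp_factor_has_derivative[OF z] has_derivative_inner[OF V W]],
      simp add: fun_eq_iff inner_complex_def algebra_simps)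

lemma hyp_coeff_has_derivative:
  assumes "z \<in> hyp_plane"
  shows "(hyp_coeff has_derivative (\<lambda>u. 2 * cnj u / of_real (1 - (norm z)\<^sup>2) +
     4 * cnj z * of_real (z \<bullet> u) / (of_real (1 - (norm z)\<^sup>2))\<^sup>2)) (at z)"
proof -
  let ?r = "1 - (norm z)\<^sup>2"
  have "((\<lambda>z. (2 * cnj z) * of_real (inverse (1 - (norm z)\<^sup>2))) has_derivative
      (\<lambda>u. (2 * cnj z) * of_real (2 * (z \<bullet> u) * (inverse ?r)\<^sup>2) +
        (2 * cnj u) * of_real (inverse ?r))) (at z)"
    by (intro has_derivative_mult has_derivative_mult_right has_derivative_cnj has_derivative_ident
        has_derivative_of_real inverse_one_minus_norm_has_derivative[OF assms])
  moreover have "(\<lambda>z. (2 * cnj z) * of_real (inverse (1 - (norm z)\<^sup>2))) = hyp_coeff"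
    by (simp add: fun_eq_iff hyp_coeff_def divide_inverse)
  ultimately show ?thesis
    by (simp add: divide_inverse power_inverse algebra_simps)
qed

text \<open>With \<open>a\<close> the coefficient, the left side is the curvature form d(a dz) on
  the pair (1, \<open>\<i>\<close>). Complex multiplication commutes, so there is no quadratic term.
  That it equals \<open>\<i>\<close> times the area density expresses curvature -1.\<close>

lemma hyp_coeff_curvature:
  assumes "z \<in> hyp_plane" and a: "(hyp_coeff has_derivative a') (at z)"
  shows "\<i> * a' 1 - a' \<i> = \<i> * of_real (hyp_factor z)"
proof -
  define r where "r = complex_of_real (1 - (norm z)\<^sup>2)"
  have r: "r \<noteq> 0" using disc_pos[OF assms(1)] unfolding r_def of_real_eq_0_iff by linarith
  have eq: "a' = (\<lambda>u. 2 * cnj u / r + 4 * cnj z * of_real (z \<bullet> u) / r\<^sup>2)"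
    using has_derivative_unique[OF a hyp_coeff_has_derivative[OF assms(1)]] by (simp add: r_def)
  have "z * cnj z = 1 - r" by (simp add: r_def complex_norm_square[symmetric])
  moreover have "z = of_real (z \<bullet> 1) + \<i> * of_real (z \<bullet> \<i>)"
    by (simp add: inner_complex_def complex_eq_iff)
  \<comment> \<open>For z = x + iy the bracket ix - y is iz, so the product is i times the squared
    norm of z.\<close>
  ultimately have *: "cnj z * (\<i> * of_real (z \<bullet> 1) - of_real (z \<bullet> \<i>)) = \<i> * (1 - r)"
    by (metis (no_types, opaque_lifting) complex_i_mult_minus mult.commute mult.left_commute
        right_diff_distrib' distrib_left diff_conv_add_uminus)
  have "\<i> * a' 1 - a' \<i> = 4 * \<i> / r + 4 * (cnj z * (\<i> * of_real (z \<bullet> 1) - of_real (z \<bullet> \<i>))) / r\<^sup>2"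
    unfolding eq using r by (simp add: field_simps power2_eq_square)
  also have "\<dots> = 4 * \<i> / r\<^sup>2" unfolding * using r by (simp add: field_simps power2_eq_square)
  also have "\<dots> = \<i> * of_real (hyp_factor z)" by (simp add: hyp_factor_def r_def)
  finally show ?thesis .
qed

section \<open>Linear algebra of the plane and uniqueness in the Koszul formula\<close>

lemma linear_complex_expand:
  assumes "linear (L::complex \<Rightarrow> 'b::real_vector)"
  shows "L v = Re v *\<^sub>R L 1 + Im v *\<^sub>R L \<i>"
proof -
  have "v = Re v *\<^sub>R 1 + Im v *\<^sub>R \<i>" by (simp add: complex_eq_iff)
  then have "L v = L (Re v *\<^sub>R 1 + Im v *\<^sub>R \<i>)" by simp
  also have "\<dots> = Re v *\<^sub>R L 1 + Im v *\<^sub>R L \<i>" by (simp add: linear_add[OF assms] linear_cmul[OF assms])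
  finally show ?thesis .
qed

text \<open>Two solutions of the Koszul formula pair equally with every vector, in particular with
  their difference; that difference is then null and hence zero.\<close>

lemma christoffel_eqI:
  assumes g: "bilinear (g z)" "\<And>x. x \<noteq> 0 \<Longrightarrow> g z x x \<noteq> (0::real)"
    and x: "\<And>w. 2 * g z x w = frechet_derivative (\<lambda>y. g y v w) (at z) u
      + frechet_derivative (\<lambda>y. g y u w) (at z) v
      - frechet_derivative (\<lambda>y. g y u v) (at z) w"
  shows "christoffel g z u v = x"
  unfolding christoffel_def
proof (rule the_equality)
  fix x'
  assume x': "\<forall>w. 2 * g z x' w = frechet_derivative (\<lambda>y. g y v w) (at z) u
      + frechet_derivative (\<lambda>y. g y u w) (at z) v
      - frechet_derivative (\<lambda>y. g y u v) (at z) w"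
  then have "2 * g z x' (x' - x) = 2 * g z x (x' - x)" using x by metis
  then have "g z (x' - x) (x' - x) = 0" using bilinear_lsub[OF g(1), of x' x "x' - x"] by simp
  then show "x' = x" using g(2)[of "x' - x"] by auto
qed (use x in blast)

text \<open>Cramer's rule for determinant one: the coordinates are the determinants of the pairs (w,
  \<open>L \<i>\<close>) and (\<open>L 1\<close>, w). The explicit formula makes differentiability
  and size of the inverse visible.\<close>

definition plane_inverse :: "(complex \<Rightarrow> complex) \<Rightarrow> complex \<Rightarrow> complex" where
  "plane_inverse L w = of_real (Im (cnj w * L \<i>)) + \<i> * of_real (Im (cnj (L 1) * w))"

lemma plane_inverse:
  assumes "linear L" "plane_det L = 1"
  shows "L (plane_inverse L w) = w" "plane_inverse L (L v) = v"
proof -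
  let ?a = "Re (L 1)" and ?b = "Im (L 1)" and ?c = "Re (L \<i>)" and ?d = "Im (L \<i>)"
  have det: "?a * ?d = 1 + ?b * ?c" using assms(2) by (simp add: plane_det_def algebra_simps)
  have L: "Re (L v) = Re v * ?a + Im v * ?c" "Im (L v) = Re v * ?b + Im v * ?d" for v
    using linear_complex_expand[OF assms(1), of v] by simp_all
  have "Re (L (plane_inverse L w)) = Re w * (?a * ?d - ?b * ?c)"
    "Im (L (plane_inverse L w)) = Im w * (?a * ?d - ?b * ?c)"
    unfolding L(1,2)[of "plane_inverse L w"] by (simp_all add: plane_inverse_def algebra_simps)
  then show "L (plane_inverse L w) = w" by (simp add: complex_eq_iff det)
  have "Re (plane_inverse L (L v)) = Re v * (?a * ?d - ?b * ?c)"
    "Im (plane_inverse L (L v)) = Im v * (?a * ?d - ?b * ?c)"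
    unfolding plane_inverse_def by (simp_all add: L[of v] algebra_simps)
  then show "plane_inverse L (L v) = v" by (simp add: complex_eq_iff det)
qed

text \<open>The formula uses only the columns of \<open>L\<close>, so a bound on the map also bounds
  its inverse; the 2 counts the coordinates.\<close>

lemma plane_inverse_bound:
  assumes "norm (L 1) \<le> M" "norm (L \<i>) \<le> M"
  shows "norm (plane_inverse L w) \<le> 2 * M * norm w"
proof -
  have "\<bar>Im (cnj w * L \<i>)\<bar> \<le> norm w * M"
    using abs_Im_le_cmod[of "cnj w * L \<i>"] mult_left_mono[OF assms(2), of "norm w"]
    by (simp add: norm_mult)
  moreover have "\<bar>Im (cnj (L 1) * w)\<bar> \<le> M * norm w"
    using abs_Im_le_cmod[of "cnj (L 1) * w"] mult_right_mono[OF assms(1), of "norm w"]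
    by (simp add: norm_mult)
  moreover have "norm (plane_inverse L w) \<le> \<bar>Im (cnj w * L \<i>)\<bar> + \<bar>Im (cnj (L 1) * w)\<bar>"
    unfolding plane_inverse_def by (rule order_trans[OF norm_triangle_ineq])
      (simp only: norm_mult norm_of_real norm_ii mult_1 order_refl)
  ultimately show ?thesis by (simp add: algebra_simps)
qed

section \<open>Metrics defined by Codazzi fields of determinant one\<close>

text \<open>The Codazzi equation is asked for constant fields only, where the bracket term
  vanishes.\<close>

locale codazzi_field =
  fixes B :: "complex \<Rightarrow> complex \<Rightarrow> complex"
  assumes linear_B: "z \<in> hyp_plane \<Longrightarrow> linear (B z)"
    and smooth_B: "smooth_on hyp_plane (\<lambda>z. B z v)"
    and det_B: "z \<in> hyp_plane \<Longrightarrow> plane_det (B z) = 1"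
    and codazzi_B: "z \<in> hyp_plane \<Longrightarrow> hyp_cov (\<lambda>y. B y v) z u = hyp_cov (\<lambda>y. B y u) z v"
begin

definition G :: "complex metric_field" where
  "G z u v = hyp_metric z (B z u) (B z v)"

text \<open>For the constant field \<open>v\<close> this is the derivative of \<open>Bv\<close>
  along \<open>u\<close>, not the tensor obtained by differentiating \<open>B\<close> alone. It will
  turn out to be \<open>B\<close> applied to the Christoffel map of \<open>G\<close>.\<close>

definition T :: "complex \<Rightarrow> complex \<Rightarrow> complex \<Rightarrow> complex" where
  "T z u v = hyp_cov (\<lambda>y. B y v) z u"

lemma B_has_derivative:
  "z \<in> hyp_plane \<Longrightarrow> ((\<lambda>y. B y v) has_derivative frechet_derivative (\<lambda>y. B y v) (at z)) (at z)"
  by (rule smooth_on_has_derivative[OF smooth_B])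

lemma B_inj: "z \<in> hyp_plane \<Longrightarrow> B z u = B z v \<longleftrightarrow> u = v"
  using plane_inverse(2)[OF linear_B det_B] by metis

lemma B_expand: "z \<in> hyp_plane \<Longrightarrow> B z v = Re v *\<^sub>R B z 1 + Im v *\<^sub>R B z \<i>"
  by (rule linear_complex_expand[OF linear_B])

lemma B_frechet_expand:
  assumes z: "z \<in> hyp_plane"
  shows "frechet_derivative (\<lambda>y. B y v) (at z) u =
    Re v *\<^sub>R frechet_derivative (\<lambda>y. B y 1) (at z) u + Im v *\<^sub>R frechet_derivative (\<lambda>y. B y \<i>) (at z) u"
proof -
  have "((\<lambda>y. Re v *\<^sub>R B y 1 + Im v *\<^sub>R B y \<i>) has_derivative (\<lambda>u.
    Re v *\<^sub>R frechet_derivative (\<lambda>y. B y 1) (at z) u + Im v *\<^sub>R frechet_derivative (\<lambda>y. B y \<i>) (at z) u)) (at z)"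
    by (intro has_derivative_add has_derivative_scaleR_right B_has_derivative[OF z])
  then have "((\<lambda>y. B y v) has_derivative (\<lambda>u.
    Re v *\<^sub>R frechet_derivative (\<lambda>y. B y 1) (at z) u + Im v *\<^sub>R frechet_derivative (\<lambda>y. B y \<i>) (at z) u)) (at z)"
    by (rule has_derivative_transform_within_open[OF _ open_ball z]) (metis B_expand)
  then show ?thesis by (simp add: frechet_derivative_at[symmetric])
qed

text \<open>Smoothness of \<open>B\<close> is given for each fixed vector, so a varying argument is
  expanded in the basis 1, \<open>\<i>\<close> before differentiating.\<close>

lemma B_apply_has_derivative:
  assumes z: "z \<in> hyp_plane" and Y: "(Y has_derivative Y') (at z)"
  shows "((\<lambda>y. B y (Y y)) has_derivative
    (\<lambda>u. B z (Y' u) + frechet_derivative (\<lambda>y. B y (Y z)) (at z) u)) (at z)"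
proof -
  let ?D = "\<lambda>v. frechet_derivative (\<lambda>y. B y v) (at z)"
  have "((\<lambda>y. Re (Y y) *\<^sub>R B y 1 + Im (Y y) *\<^sub>R B y \<i>) has_derivative
    (\<lambda>u. (Re (Y z) *\<^sub>R ?D 1 u + Re (Y' u) *\<^sub>R B z 1) + (Im (Y z) *\<^sub>R ?D \<i> u + Im (Y' u) *\<^sub>R B z \<i>))) (at z)"
    by (intro has_derivative_add has_derivative_scaleR has_derivative_Re has_derivative_Im
        Y B_has_derivative[OF z])
  then have main: "((\<lambda>y. B y (Y y)) has_derivative
    (\<lambda>u. (Re (Y z) *\<^sub>R ?D 1 u + Re (Y' u) *\<^sub>R B z 1) + (Im (Y z) *\<^sub>R ?D \<i> u + Im (Y' u) *\<^sub>R B z \<i>))) (at z)"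
    by (rule has_derivative_transform_within_open[OF _ open_ball z]) (metis B_expand)
  have "B z (Y' u) = Re (Y' u) *\<^sub>R B z 1 + Im (Y' u) *\<^sub>R B z \<i>" for u by (rule B_expand[OF z])
  moreover have "?D (Y z) u = Re (Y z) *\<^sub>R ?D 1 u + Im (Y z) *\<^sub>R ?D \<i> u" for u
    by (rule B_frechet_expand[OF z])
  ultimately show ?thesis
    by (intro has_derivative_eq_rhs[OF main]) (simp only: fun_eq_iff add_ac simp_thms)
qed

lemma G_has_derivative:
  assumes "z \<in> hyp_plane"
  shows "((\<lambda>y. G y v w) has_derivative
    (\<lambda>u. hyp_metric z (T z u v) (B z w) + hyp_metric z (B z v) (T z u w))) (at z)"
  using hyp_metric_has_derivative[OF assms B_has_derivative[OF assms] B_has_derivative[OF assms]]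
  unfolding G_def T_def hyp_cov_def .

lemma G_frechet:
  "z \<in> hyp_plane \<Longrightarrow> frechet_derivative (\<lambda>y. G y v w) (at z) u =
    hyp_metric z (T z u v) (B z w) + hyp_metric z (B z v) (T z u w)"
  by (simp add: frechet_derivative_at[OF G_has_derivative, symmetric])

lemma T_commute: "z \<in> hyp_plane \<Longrightarrow> T z u v = T z v u"
  unfolding T_def by (rule codazzi_B)

lemma G_bilinear: "z \<in> hyp_plane \<Longrightarrow> bilinear (G z)"
  unfolding bilinear_def G_def hyp_metric_eq
  using linear_B[of z]
  by (auto intro!: linearI simp: linear_add linear_cmul algebra_simps)

lemma G_pos:
  assumes "z \<in> hyp_plane" "u \<noteq> 0"
  shows "G z u u > 0"
proof -
  have "B z u \<noteq> B z 0" using B_inj[OF assms(1)] assms(2) by blast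
  then have "B z u \<noteq> 0" using linear_0[OF linear_B[OF assms(1)]] by simp
  then show ?thesis using hyp_factor_pos[OF assms(1)] by (simp add: G_def hyp_metric_eq)
qed

lemma riemannian_G: "riemannian_metric hyp_plane G"
proof -
  have "smooth_on hyp_plane (\<lambda>z. G z u v)" for u v
    unfolding G_def hyp_metric_eq
    by (intro smooth_on_bounded_bilinear[OF bounded_bilinear_mult] hyp_factor_smooth open_ball
        smooth_on_bounded_bilinear[OF bounded_bilinear_inner] smooth_B)
  then show ?thesis
    unfolding riemannian_metric_def using G_bilinear G_pos
    by (auto simp: G_def hyp_metric_commute)
qed

text \<open>Metric compatibility splits the three derivatives into six products. Symmetry of
  \<open>T\<close> cancels four of them and makes the remaining two equal.\<close>

lemma G_koszul:
  assumes z: "z \<in> hyp_plane"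
  shows "2 * G z (plane_inverse (B z) (T z u v)) w = frechet_derivative (\<lambda>y. G y v w) (at z) u
    + frechet_derivative (\<lambda>y. G y u w) (at z) v - frechet_derivative (\<lambda>y. G y u v) (at z) w"
  unfolding G_frechet[OF z]
  using T_commute[OF z, of u v] T_commute[OF z, of u w] T_commute[OF z, of v w]
  by (simp add: G_def plane_inverse(1)[OF linear_B[OF z] det_B[OF z]] hyp_metric_commute)

lemma christoffel_G:
  assumes z: "z \<in> hyp_plane"
  shows "christoffel G z u v = plane_inverse (B z) (T z u v)"
proof (rule christoffel_eqI[where g = G and z = z and u = u and v = v])
  show "G z x x \<noteq> 0" if "x \<noteq> 0" for x using G_pos[OF z that] by simp
qed (rule G_bilinear[OF z], rule G_koszul[OF z])

lemma B_christoffel: "z \<in> hyp_plane \<Longrightarrow> B z (christoffel G z u v) = T z u v"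
  by (simp add: christoffel_G plane_inverse(1)[OF linear_B det_B])

lemma B_covariant_derivative:
  assumes z: "z \<in> hyp_plane" and Y: "Y differentiable (at z)"
  shows "B z (covariant_derivative G X Y z) = hyp_cov (\<lambda>y. B y (Y y)) z (X z)"
proof -
  have "(Y has_derivative frechet_derivative Y (at z)) (at z)"
    using Y frechet_derivative_works by blast
  from frechet_derivative_at[OF B_apply_has_derivative[OF z this]]
  have "frechet_derivative (\<lambda>y. B y (Y y)) (at z) (X z) =
      B z (frechet_derivative Y (at z) (X z)) + frechet_derivative (\<lambda>y. B y (Y z)) (at z) (X z)"
    by metis
  then show ?thesis
    by (simp add: covariant_derivative_def linear_add[OF linear_B[OF z]] B_christoffel[OF z]
        hyp_cov_def T_def)
qed

text \<open>Meant for iterated covariant derivatives: the inner one is known only through its image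
  \<open>W\<close> under \<open>B\<close>, and the explicit inverse turns differentiability of
  \<open>W\<close> into that of \<open>Y\<close>.\<close>

lemma B_covariant_derivative_field:
  assumes z: "z \<in> hyp_plane" and W: "W differentiable (at z)"
    and Y: "\<And>y. y \<in> hyp_plane \<Longrightarrow> B y (Y y) = W y"
  shows "B z (covariant_derivative G X Y z) = hyp_cov W z (X z)"
proof -
  have W': "(W has_derivative frechet_derivative W (at z)) (at z)"
    using W frechet_derivative_works by blast
  have "(\<lambda>y. plane_inverse (B y) (W y)) differentiable (at z)"
    unfolding plane_inverse_def differentiable_def
    by (rule exI, (rule has_derivative_add has_derivative_mult_right has_derivative_of_real
        has_derivative_Im has_derivative_mult has_derivative_cnj B_has_derivative[OF z] W')+)
  then obtain P where "((\<lambda>y. plane_inverse (B y) (W y)) has_derivative P) (at z)"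
    by (auto simp: differentiable_def)
  then have "(Y has_derivative P) (at z)"
    by (rule has_derivative_transform_within_open[OF _ open_ball z])
       (metis Y plane_inverse(2) linear_B det_B)
  then have "Y differentiable (at z)" by (auto simp: differentiable_def)
  from B_covariant_derivative[OF z this]
  have "B z (covariant_derivative G X Y z) = hyp_cov (\<lambda>y. B y (Y y)) z (X z)" .
  moreover have "frechet_derivative W (at z) = frechet_derivative (\<lambda>y. B y (Y y)) (at z)"
    by (rule frechet_derivative_transform_within_open[OF W open_ball z]) (simp add: Y)
  ultimately show ?thesis by (simp add: hyp_cov_def Y[OF z])
qed

lemma T_has_derivative:
  assumes z: "z \<in> hyp_plane"
  shows "((\<lambda>y. T y u v) has_derivative (\<lambda>w.
    frechet_derivative (\<lambda>y. frechet_derivative (\<lambda>y. B y v) (at y) u) (at z) w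
    + (hyp_coeff z * u * frechet_derivative (\<lambda>y. B y v) (at z) w
       + frechet_derivative hyp_coeff (at z) w * u * B z v))) (at z)"
proof -
  have "((\<lambda>y. frechet_derivative (\<lambda>y. B y v) (at y) u) has_derivative
      frechet_derivative (\<lambda>y. frechet_derivative (\<lambda>y. B y v) (at y) u) (at z)) (at z)"
    by (rule smooth_on_has_derivative[OF smooth_on_frechet_derivative[OF smooth_B] z])
  moreover have "(hyp_coeff has_derivative frechet_derivative hyp_coeff (at z)) (at z)"
    using differentiableI[OF hyp_coeff_has_derivative[OF z]] by (simp add: frechet_derivative_works)
  ultimately show ?thesis unfolding T_def hyp_cov_def
    by (intro has_derivative_add has_derivative_mult has_derivative_mult_left B_has_derivative[OF z])
qed

text \<open>After applying \<open>B\<close>, this is the curvature of \<open>hyp_cov\<close> acting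
  on the field \<open>B \<i>\<close>. Second derivatives cancel by symmetry, first-order and
  quadratic terms by commutativity, and only the derivative of \<open>hyp_coeff\<close>
  remains.\<close>

lemma B_riemann_curvature:
  assumes z: "z \<in> hyp_plane"
  shows "B z (riemann_curvature G (\<lambda>_. 1) (\<lambda>_. \<i>) (\<lambda>_. \<i>) z) = \<i> * of_real (hyp_factor z) * B z \<i>"
proof -
  have inner: "B y (covariant_derivative G (\<lambda>_. u) (\<lambda>_. v) y) = T y u v" if "y \<in> hyp_plane" for y u v
    using B_covariant_derivative[OF that differentiable_const] by (simp add: T_def)
  have outer: "B z (covariant_derivative G (\<lambda>_. w) (covariant_derivative G (\<lambda>_. u) (\<lambda>_. v)) z) =
     hyp_cov (\<lambda>y. T y u v) z w" for u v w
    by (rule B_covariant_derivative_field[OF z _ inner])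
       (use T_has_derivative[OF z] in \<open>auto simp: differentiable_def\<close>)
  have "lie_bracket (\<lambda>_. 1) (\<lambda>_. \<i>) = (\<lambda>_::complex. 0::complex)"
    by (simp add: lie_bracket_def fun_eq_iff)
  then have zero: "B z (covariant_derivative G (lie_bracket (\<lambda>_. 1) (\<lambda>_. \<i>)) (\<lambda>_. \<i>) z) = 0"
    using B_covariant_derivative[OF z differentiable_const]
    by (simp add: hyp_cov_def linear_0[OF has_derivative_linear[OF B_has_derivative[OF z]]])
  have fT: "frechet_derivative (\<lambda>y. T y u v) (at z) w =
      frechet_derivative (\<lambda>y. frechet_derivative (\<lambda>y. B y v) (at y) u) (at z) w
      + (hyp_coeff z * u * frechet_derivative (\<lambda>y. B y v) (at z) w
       + frechet_derivative hyp_coeff (at z) w * u * B z v)" for u v w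
    by (simp add: frechet_derivative_at[OF T_has_derivative[OF z], symmetric])
  have "(hyp_coeff has_derivative frechet_derivative hyp_coeff (at z)) (at z)"
    using differentiableI[OF hyp_coeff_has_derivative[OF z]] by (simp add: frechet_derivative_works)
  note a = hyp_coeff_curvature[OF z this]
  note sym = second_derivative_symmetric[OF open_ball z smooth_B, of \<i> 1 \<i>]
  have "B z (riemann_curvature G (\<lambda>_. 1) (\<lambda>_. \<i>) (\<lambda>_. \<i>) z) =
      hyp_cov (\<lambda>y. T y \<i> \<i>) z 1 - hyp_cov (\<lambda>y. T y 1 \<i>) z \<i>"
    unfolding riemann_curvature_def by (simp add: linear_diff[OF linear_B[OF z]] outer zero)
  also have "\<dots> = (\<i> * frechet_derivative hyp_coeff (at z) 1 - frechet_derivative hyp_coeff (at z) \<i>) * B z \<i>"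
    unfolding hyp_cov_def fT using sym by (simp add: T_def hyp_cov_def algebra_simps)
  finally show ?thesis unfolding a by simp
qed

text \<open>A Gram determinant is multiplied by the squared determinant of the map. All metrics
  \<open>G\<close> thus share the area form of the hyperbolic metric, which also yields area
  preservation of the identity.\<close>

lemma G_det: "z \<in> hyp_plane \<Longrightarrow> G z 1 1 * G z \<i> \<i> - (G z 1 \<i>)\<^sup>2 = (hyp_factor z)\<^sup>2"
proof -
  assume z: "z \<in> hyp_plane"
  have "G z 1 1 * G z \<i> \<i> - (G z 1 \<i>)\<^sup>2 = (hyp_factor z)\<^sup>2 * (plane_det (B z))\<^sup>2"
    unfolding G_def hyp_metric_eq plane_det_def inner_complex_def
    by (simp add: algebra_simps power2_eq_square)
  then show ?thesis by (simp add: det_B[OF z])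
qed

lemma hyperbolic_G: "hyperbolic_metric hyp_plane G"
proof -
  have "gauss_curvature G z = -1" if z: "z \<in> hyp_plane" for z
  proof -
    \<comment> \<open>Rotating one argument by \<open>\<i>\<close> turns the inner product into a
      determinant, here with a minus sign. One factor \<open>hyp_factor z\<close> comes from the
      curvature, the other from the metric.\<close>
    have "G z (riemann_curvature G (\<lambda>_. 1) (\<lambda>_. \<i>) (\<lambda>_. \<i>) z) 1 =
        - (hyp_factor z)\<^sup>2 * plane_det (B z)"
      unfolding G_def B_riemann_curvature[OF z] hyp_metric_eq plane_det_def inner_complex_def
      by (simp add: algebra_simps power2_eq_square)
    then show ?thesis
      unfolding gauss_curvature_def G_det[OF z] using hyp_factor_pos[OF z] by (simp add: det_B[OF z])
  qed
  then show ?thesis by (simp add: hyperbolic_metric_def riemannian_G)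
qed

lemma T_expand:
  assumes z: "z \<in> hyp_plane"
  shows "T z u v = (Re u * Re v) *\<^sub>R T z 1 1 + (Re u * Im v) *\<^sub>R T z 1 \<i> +
    (Im u * Re v) *\<^sub>R T z \<i> 1 + (Im u * Im v) *\<^sub>R T z \<i> \<i>"
proof -
  have u: "T z u v = Re u *\<^sub>R T z 1 v + Im u *\<^sub>R T z \<i> v" for u v
  proof -
    have "linear (\<lambda>u. T z u v)"
      unfolding T_def hyp_cov_def
      by (rule linear_compose_add[OF has_derivative_linear[OF B_has_derivative[OF z]]])
         (auto intro!: linearI simp: algebra_simps)
    then show ?thesis by (rule linear_complex_expand)
  qed
  have v: "T z u v = Re v *\<^sub>R T z u 1 + Im v *\<^sub>R T z u \<i>" for u v
  proof -
    have "T z u v = Re v *\<^sub>R frechet_derivative (\<lambda>y. B y 1) (at z) u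
        + Im v *\<^sub>R frechet_derivative (\<lambda>y. B y \<i>) (at z) u
        + hyp_coeff z * u * (Re v *\<^sub>R B z 1 + Im v *\<^sub>R B z \<i>)"
      unfolding T_def hyp_cov_def
      by (simp only: B_frechet_expand[OF z, symmetric] B_expand[OF z, symmetric])
    then show ?thesis by (simp add: T_def hyp_cov_def algebra_simps)
  qed
  show ?thesis
    by (subst u, subst (1 2) v) (simp add: scaleR_add_right)
qed

end

section \<open>Completeness\<close>

definition admissible_paths ::
    "'a::real_normed_vector set \<Rightarrow> 'a metric_field \<Rightarrow> 'a \<Rightarrow> 'a \<Rightarrow> (real \<Rightarrow> 'a) set" where
  "admissible_paths S g x y = {\<gamma>. valid_path \<gamma> \<and> path_image \<gamma> \<subseteq> S \<and> pathstart \<gamma> = x \<and>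
     pathfinish \<gamma> = y \<and> riemannian_speed g \<gamma> integrable_on {0..1}}"

definition riemannian_length :: "'a::real_normed_vector metric_field \<Rightarrow> (real \<Rightarrow> 'a) \<Rightarrow> real" where
  "riemannian_length g \<gamma> = integral {0..1} (riemannian_speed g \<gamma>)"

lemma riemannian_dist_eq:
  "x \<in> S \<Longrightarrow> y \<in> S \<Longrightarrow>
    riemannian_dist S g x y = Inf (riemannian_length g ` admissible_paths S g x y)"
  unfolding riemannian_dist_def riemannian_length_def admissible_paths_def
  by (auto intro!: arg_cong[where f = Inf])

lemma valid_path_differentiable:
  assumes "valid_path \<gamma>"
  obtains K where "finite K" "\<And>t. t \<in> {0..1} - K \<Longrightarrow> \<gamma> differentiable (at t)"
  using assms unfolding valid_path_def piecewise_C1_differentiable_on_def C1_differentiable_on_eq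
  by blast

text \<open>The length is unchanged by the affine substitution; the finitely many exceptional
  parameters are reflected along with the path and do not affect the integral. This gives symmetry
  of the distance.\<close>

lemma admissible_paths_reverse:
  assumes g: "\<And>z u. z \<in> S \<Longrightarrow> g z (- u) (- u) = g z u u"
    and \<gamma>: "\<gamma> \<in> admissible_paths S g x y"
  shows "reversepath \<gamma> \<in> admissible_paths S g y x"
    and "riemannian_length g (reversepath \<gamma>) = riemannian_length g \<gamma>"
proof -
  have valid: "valid_path \<gamma>" and S: "path_image \<gamma> \<subseteq> S" and ends: "pathstart \<gamma> = x" "pathfinish \<gamma> = y"
    and int: "riemannian_speed g \<gamma> integrable_on {0..1}"
    using \<gamma> by (auto simp: admissible_paths_def)
  obtain K where K: "finite K" "\<And>t. t \<in> {0..1} - K \<Longrightarrow> \<gamma> differentiable (at t)"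
    using valid_path_differentiable[OF valid] by blast
  have speed: "riemannian_speed g (reversepath \<gamma>) t = riemannian_speed g \<gamma> (1 - t)"
    if t: "t \<in> {0..1} - (\<lambda>t. 1 - t) ` K" for t
  proof -
    have mem: "1 - t \<in> {0..1} - K" using t by (force simp: image_iff)
    then have "\<gamma> differentiable (at (1 - t))" by (rule K(2))
    then have "(\<gamma> has_vector_derivative vector_derivative \<gamma> (at (1 - t))) (at (1 - t))"
      using vector_derivative_works by blast
    moreover have "((\<lambda>t. 1 - t) has_vector_derivative (-1)) (at t)"
      by (auto intro!: derivative_eq_intros)
    ultimately have "(reversepath \<gamma> has_vector_derivative - vector_derivative \<gamma> (at (1 - t))) (at t)"
      using vector_diff_chain_at[of "\<lambda>t. 1 - t" "-1" t \<gamma>] by (simp add: o_def reversepath_def)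
    then have "vector_derivative (reversepath \<gamma>) (at t) = - vector_derivative \<gamma> (at (1 - t))"
      by (rule vector_derivative_at)
    moreover have "\<gamma> (1 - t) \<in> S" using S mem by (auto simp: path_image_def)
    ultimately show ?thesis by (simp add: riemannian_speed_def reversepath_def g)
  qed
  have "(riemannian_speed g \<gamma> has_integral riemannian_length g \<gamma>) (cbox 0 1)"
    using int by (simp add: riemannian_length_def integrable_integral)
  from has_integral_affinity[OF this, of "-1" 1]
  have "((\<lambda>t. riemannian_speed g \<gamma> (1 - t)) has_integral riemannian_length g \<gamma>) {0..1}"
    by simp
  then have *: "(riemannian_speed g (reversepath \<gamma>) has_integral riemannian_length g \<gamma>) {0..1}"
    by (rule has_integral_spike_finite[of "(\<lambda>t. 1 - t) ` K", rotated 2]) (use K(1) speed in auto)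
  then show "riemannian_length g (reversepath \<gamma>) = riemannian_length g \<gamma>"
    unfolding riemannian_length_def by (rule integral_unique)
  show "reversepath \<gamma> \<in> admissible_paths S g y x"
    using * valid S ends by (auto simp: admissible_paths_def integrable_on_def)
qed

text \<open>Each half is run at double speed on an interval of half the length, so the factors
  cancel; the hypothesis on \<open>g\<close> supplies this homogeneity. The junction 1/2 joins the
  exceptional parameters, since the derivatives may disagree there.\<close>

lemma admissible_paths_join:
  assumes g: "\<And>z u. z \<in> S \<Longrightarrow> g z (2 *\<^sub>R u) (2 *\<^sub>R u) = 4 * g z u u"
    and \<gamma>1: "\<gamma>1 \<in> admissible_paths S g x y" and \<gamma>2: "\<gamma>2 \<in> admissible_paths S g y w"
  shows "\<gamma>1 +++ \<gamma>2 \<in> admissible_paths S g x w"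
    and "riemannian_length g (\<gamma>1 +++ \<gamma>2) = riemannian_length g \<gamma>1 + riemannian_length g \<gamma>2"
proof -
  have valid: "valid_path \<gamma>1" "valid_path \<gamma>2" and S: "path_image \<gamma>1 \<subseteq> S" "path_image \<gamma>2 \<subseteq> S"
    and ends: "pathstart \<gamma>1 = x" "pathfinish \<gamma>1 = y" "pathstart \<gamma>2 = y" "pathfinish \<gamma>2 = w"
    and int: "riemannian_speed g \<gamma>1 integrable_on {0..1}" "riemannian_speed g \<gamma>2 integrable_on {0..1}"
    using \<gamma>1 \<gamma>2 by (auto simp: admissible_paths_def)
  obtain K1 where K1: "finite K1" "\<And>t. t \<in> {0..1} - K1 \<Longrightarrow> \<gamma>1 differentiable (at t)"
    using valid_path_differentiable[OF valid(1)] by blast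
  obtain K2 where K2: "finite K2" "\<And>t. t \<in> {0..1} - K2 \<Longrightarrow> \<gamma>2 differentiable (at t)"
    using valid_path_differentiable[OF valid(2)] by blast
  let ?J = "\<gamma>1 +++ \<gamma>2"
  have speed1: "riemannian_speed g ?J t = 2 * riemannian_speed g \<gamma>1 (2 * t)"
    if t: "t \<in> {0..1/2} - insert (1/2) ((\<lambda>t. t / 2) ` K1)" for t
  proof -
    have mem: "2 * t \<in> {0..1} - K1" using t imageI[of "2 * t" K1 "\<lambda>t. t / 2"] by auto
    then have "(\<gamma>1 has_vector_derivative vector_derivative \<gamma>1 (at (2 * t))) (at (2 * t))"
      using K1(2) vector_derivative_works by blast
    moreover have "((\<lambda>t. 2 * t) has_vector_derivative 2) (at t)"
      by (auto intro!: derivative_eq_intros)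
    ultimately have "((\<lambda>t. \<gamma>1 (2 * t)) has_vector_derivative 2 *\<^sub>R vector_derivative \<gamma>1 (at (2 * t))) (at t)"
      using vector_diff_chain_at[of "\<lambda>t. 2 * t" 2 t \<gamma>1] by (simp add: o_def)
    then have "(?J has_vector_derivative 2 *\<^sub>R vector_derivative \<gamma>1 (at (2 * t))) (at t)"
      by (rule has_vector_derivative_transform_within_open[of _ _ _ "{..<1/2}"])
         (use t in \<open>auto simp: joinpaths_def\<close>)
    then have "vector_derivative ?J (at t) = 2 *\<^sub>R vector_derivative \<gamma>1 (at (2 * t))"
      by (rule vector_derivative_at)
    moreover have "?J t = \<gamma>1 (2 * t)" using t by (simp add: joinpaths_def)
    moreover have "\<gamma>1 (2 * t) \<in> S" using S mem by (auto simp: path_image_def)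
    ultimately show ?thesis by (simp add: riemannian_speed_def g real_sqrt_mult)
  qed
  have speed2: "riemannian_speed g ?J t = 2 * riemannian_speed g \<gamma>2 (2 * t - 1)"
    if t: "t \<in> {1/2..1} - insert (1/2) ((\<lambda>t. (t + 1) / 2) ` K2)" for t
  proof -
    have mem: "2 * t - 1 \<in> {0..1} - K2" using t imageI[of "2 * t - 1" K2 "\<lambda>t. (t + 1) / 2"] by auto
    then have "(\<gamma>2 has_vector_derivative vector_derivative \<gamma>2 (at (2 * t - 1))) (at (2 * t - 1))"
      using K2(2) vector_derivative_works by blast
    moreover have "((\<lambda>t. 2 * t - 1) has_vector_derivative 2) (at t)"
      by (auto intro!: derivative_eq_intros)
    ultimately have "((\<lambda>t. \<gamma>2 (2 * t - 1)) has_vector_derivative 2 *\<^sub>R vector_derivative \<gamma>2 (at (2 * t - 1))) (at t)"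
      using vector_diff_chain_at[of "\<lambda>t. 2 * t - 1" 2 t \<gamma>2] by (simp add: o_def)
    then have "(?J has_vector_derivative 2 *\<^sub>R vector_derivative \<gamma>2 (at (2 * t - 1))) (at t)"
      by (rule has_vector_derivative_transform_within_open[of _ _ _ "{1/2<..}"])
         (use t in \<open>auto simp: joinpaths_def\<close>)
    then have "vector_derivative ?J (at t) = 2 *\<^sub>R vector_derivative \<gamma>2 (at (2 * t - 1))"
      by (rule vector_derivative_at)
    moreover have "?J t = \<gamma>2 (2 * t - 1)" using t by (simp add: joinpaths_def)
    moreover have "\<gamma>2 (2 * t - 1) \<in> S" using S mem by (auto simp: path_image_def)
    ultimately show ?thesis by (simp add: riemannian_speed_def g real_sqrt_mult)
  qed
  have h1: "(riemannian_speed g ?J has_integral riemannian_length g \<gamma>1) {0..1/2}"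
  proof -
    have "(riemannian_speed g \<gamma>1 has_integral riemannian_length g \<gamma>1) (cbox 0 1)"
      using int by (simp add: riemannian_length_def integrable_integral)
    from has_integral_affinity[OF this, of 2 0]
    have "((\<lambda>t. riemannian_speed g \<gamma>1 (2 * t)) has_integral riemannian_length g \<gamma>1 / 2) {0..1/2}"
      by simp
    from has_integral_mult_right[OF this, of 2]
    have "((\<lambda>t. 2 * riemannian_speed g \<gamma>1 (2 * t)) has_integral riemannian_length g \<gamma>1) {0..1/2}"
      by simp
    then show ?thesis
      by (rule has_integral_spike_finite[of "insert (1/2) ((\<lambda>t. t / 2) ` K1)", rotated 2])
         (use K1(1) speed1 in auto)
  qed
  have h2: "(riemannian_speed g ?J has_integral riemannian_length g \<gamma>2) {1/2..1}"
  proof -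
    have "(riemannian_speed g \<gamma>2 has_integral riemannian_length g \<gamma>2) (cbox 0 1)"
      using int by (simp add: riemannian_length_def integrable_integral)
    from has_integral_affinity[OF this, of 2 "-1"]
    moreover have "(\<lambda>t. t / 2 + 1 / 2) ` {0..1} = {1/2..1::real}"
      using image_affinity_atLeastAtMost_div[of 2 "1/2" 0 "1::real"] by simp
    ultimately have "((\<lambda>t. riemannian_speed g \<gamma>2 (2 * t - 1)) has_integral
        riemannian_length g \<gamma>2 / 2) {1/2..1}"
      by simp
    from has_integral_mult_right[OF this, of 2]
    have "((\<lambda>t. 2 * riemannian_speed g \<gamma>2 (2 * t - 1)) has_integral riemannian_length g \<gamma>2) {1/2..1}"
      by simp
    then show ?thesis
      by (rule has_integral_spike_finite[of "insert (1/2) ((\<lambda>t. (t + 1) / 2) ` K2)", rotated 2])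
         (use K2(1) speed2 in auto)
  qed
  have *: "(riemannian_speed g ?J has_integral riemannian_length g \<gamma>1 + riemannian_length g \<gamma>2) {0..1}"
    by (rule has_integral_combine[OF _ _ h1 h2]) auto
  then show "riemannian_length g ?J = riemannian_length g \<gamma>1 + riemannian_length g \<gamma>2"
    unfolding riemannian_length_def[of g ?J] by (rule integral_unique)
  show "?J \<in> admissible_paths S g x w"
    using * valid S ends path_image_join_subset[of \<gamma>1 \<gamma>2]
    by (auto simp: admissible_paths_def integrable_on_def intro: valid_path_join)
qed

text \<open>Segments have constant velocity, hence continuous speed. They are the test paths behind
  all upper bounds for the distance.\<close>

lemma linepath_admissible:
  assumes g: "riemannian_metric S g" and S: "closed_segment x y \<subseteq> S"
    and le: "\<And>z. z \<in> closed_segment x y \<Longrightarrow> g z (y - x) (y - x) \<le> M\<^sup>2" and M: "M \<ge> 0"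
  shows "linepath x y \<in> admissible_paths S g x y" "riemannian_length g (linepath x y) \<le> M"
proof -
  have "continuous_on S (\<lambda>z. g z (y - x) (y - x))"
    using g by (auto simp: riemannian_metric_def intro: smooth_on_imp_continuous_on)
  then have "continuous_on {0..1} ((\<lambda>z. g z (y - x) (y - x)) \<circ> linepath x y)"
    using S by (intro continuous_on_compose) (auto simp: linepath_image_01 intro: continuous_on_subset)
  moreover have speed: "riemannian_speed g (linepath x y) = (\<lambda>t. sqrt (g (linepath x y t) (y - x) (y - x)))"
    by (simp add: riemannian_speed_def fun_eq_iff)
  ultimately have int: "riemannian_speed g (linepath x y) integrable_on {0..1}"
    by (auto simp: o_def intro!: integrable_continuous_real continuous_on_real_sqrt)
  then show "linepath x y \<in> admissible_paths S g x y"
    using S by (auto simp: admissible_paths_def)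
  have "riemannian_length g (linepath x y) \<le> integral {0..1::real} (\<lambda>_. M)"
    unfolding riemannian_length_def
    by (rule integral_le[OF int])
       (use le M in \<open>auto simp: speed linepath_in_path real_le_lsqrt\<close>)
  then show "riemannian_length g (linepath x y) \<le> M" by simp
qed

text \<open>The fundamental theorem of calculus, with finitely many exceptions, writes the increment
  of \<open>f\<close> as an integral of its derivative along the path, and \<open>le\<close> bounds
  that by the speed. So a function with bounded gradient bounds distances from below.\<close>

lemma riemannian_length_lower_bound:
  fixes f :: "'a::real_normed_vector \<Rightarrow> 'b::banach"
  assumes f: "\<And>z. z \<in> S \<Longrightarrow> (f has_derivative f' z) (at z)"
    and le: "\<And>z u. z \<in> S \<Longrightarrow> c * norm (f' z u) \<le> sqrt (g z u u)" and c: "c > 0"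
    and \<gamma>: "\<gamma> \<in> admissible_paths S g x y"
  shows "c * norm (f y - f x) \<le> riemannian_length g \<gamma>"
proof -
  have valid: "valid_path \<gamma>" and S: "path_image \<gamma> \<subseteq> S" and ends: "pathstart \<gamma> = x" "pathfinish \<gamma> = y"
    and int: "riemannian_speed g \<gamma> integrable_on {0..1}"
    using \<gamma> by (auto simp: admissible_paths_def)
  obtain K where K: "finite K" "\<And>t. t \<in> {0..1} - K \<Longrightarrow> \<gamma> differentiable (at t)"
    using valid_path_differentiable[OF valid] by blast
  have mem: "\<gamma> t \<in> S" if "t \<in> {0..1}" for t using S that by (auto simp: path_image_def)
  let ?h = "\<lambda>t. f' (\<gamma> t) (vector_derivative \<gamma> (at t))"
  have cont: "continuous_on {0..1} (\<lambda>t. f (\<gamma> t))"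
  proof (rule continuous_on_compose2[of S f])
    show "continuous_on S f"
      by (rule has_derivative_continuous_on) (use f has_derivative_at_withinI in blast)
    show "continuous_on {0..1} \<gamma>" using valid_path_imp_path[OF valid] by (simp add: path_def)
  qed (use mem in auto)
  have "(?h has_integral f (\<gamma> 1) - f (\<gamma> 0)) {0..1}"
  proof (rule fundamental_theorem_of_calculus_interior_strong[OF K(1) _ _ cont])
    fix t assume t: "t \<in> {0<..<1::real} - K"
    then have "(\<gamma> has_vector_derivative vector_derivative \<gamma> (at t)) (at t)"
      using K(2)[of t] vector_derivative_works by force
    from vector_derivative_diff_chain_within[OF this, of f "f' (\<gamma> t)"] f[OF mem[of t]] t
    show "((\<lambda>t. f (\<gamma> t)) has_vector_derivative ?h t) (at t)"
      by (auto simp: o_def intro: has_derivative_at_withinI)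
  qed simp
  then have h: "(?h has_integral f y - f x) {0..1}"
    using ends by (simp add: pathstart_def pathfinish_def)
  have "norm (integral {0..1} ?h) \<le> integral {0..1} (\<lambda>t. inverse c * riemannian_speed g \<gamma> t)"
  proof (rule integral_norm_bound_integral)
    show "?h integrable_on {0..1}" using h by (auto simp: integrable_on_def)
    show "(\<lambda>t. inverse c * riemannian_speed g \<gamma> t) integrable_on {0..1}"
      using integrable_on_cmult_left[OF int] by simp
    show "norm (?h t) \<le> inverse c * riemannian_speed g \<gamma> t" if "t \<in> {0..1}" for t
      using le[OF mem[OF that]] c by (simp add: riemannian_speed_def field_simps)
  qed
  then have "norm (f y - f x) \<le> inverse c * riemannian_length g \<gamma>"
    using integral_unique[OF h] by (simp add: riemannian_length_def)
  then show ?thesis using c by (simp add: field_simps)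
qed

text \<open>Two functions of bounded gradient suffice, without geodesics. The identity makes a
  Cauchy sequence Euclidean Cauchy; the logarithm of \<open>1 - (norm z)\<^sup>2\<close> keeps its
  tail in a smaller closed disc. There segments bound the distance by a multiple of the Euclidean
  one, so the Euclidean limit is the limit.\<close>

lemma complete_metric_bilipschitz_hyperbolic:
  assumes g: "riemannian_metric hyp_plane g" and c: "c > 0"
    and lower: "\<And>z u. z \<in> hyp_plane \<Longrightarrow> c * sqrt (hyp_metric z u u) \<le> sqrt (g z u u)"
    and upper: "\<And>z u. z \<in> hyp_plane \<Longrightarrow> sqrt (g z u u) \<le> C * sqrt (hyp_metric z u u)"
  shows "complete_metric hyp_plane g"
proof -
  let ?d = "riemannian_dist hyp_plane g" and ?P = "admissible_paths hyp_plane g"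
  have bil: "bilinear (g z)" and pos: "u \<noteq> 0 \<Longrightarrow> g z u u > 0" if "z \<in> hyp_plane" for z u
    using g that by (auto simp: riemannian_metric_def)
  have nonneg: "g z u u \<ge> 0" if "z \<in> hyp_plane" for z u
    using pos[OF that, of u] bilinear_lzero[OF bil[OF that]] by (cases "u = 0") auto
  have neg: "g z (- u) (- u) = g z u u" if "z \<in> hyp_plane" for z u
    using bil[OF that] by (simp add: bilinear_lneg bilinear_rneg)
  have double: "g z (2 *\<^sub>R u) (2 *\<^sub>R u) = 4 * g z u u" if "z \<in> hyp_plane" for z u
    using bil[OF that] by (simp add: bilinear_lmul bilinear_rmul)
  have hyp_norm: "sqrt (hyp_metric z u u) = 2 * norm u / (1 - (norm z)\<^sup>2)" if "z \<in> hyp_plane" for z u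
    using disc_pos[OF that]
    by (simp add: hyp_metric_def real_sqrt_divide real_sqrt_mult flip: power2_norm_eq_inner)
  \<comment> \<open>The conformal length scale on the disc of radius \<open>r\<close> is at most
    that on its rim. The absolute value of \<open>C\<close> makes the length bound
    nonnegative.\<close>
  have seg_upper: "linepath x y \<in> ?P x y \<and> riemannian_length g (linepath x y) \<le>
      \<bar>C\<bar> * (2 * norm (y - x) / (1 - r\<^sup>2))"
    if r: "r < 1" and xy: "x \<in> cball 0 r" "y \<in> cball 0 r" for x y r
  proof -
    have seg: "closed_segment x y \<subseteq> cball 0 r" using xy by (simp add: closed_segment_subset)
    have r0: "0 \<le> r" using xy(1) norm_ge_zero[of x] by (simp del: norm_ge_zero)
    have "1 - r\<^sup>2 > 0" using r r0 by (simp add: abs_square_less_1)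
    have "g z (y - x) (y - x) \<le> (\<bar>C\<bar> * (2 * norm (y - x) / (1 - r\<^sup>2)))\<^sup>2"
      if z: "z \<in> closed_segment x y" for z
    proof -
      have nz: "norm z \<le> r" using seg z by auto
      then have zD: "z \<in> hyp_plane" using r by simp
      have "(norm z)\<^sup>2 \<le> r\<^sup>2" using nz by (simp add: power_mono)
      then have "2 * norm (y - x) / (1 - (norm z)\<^sup>2) \<le> 2 * norm (y - x) / (1 - r\<^sup>2)"
        using \<open>1 - r\<^sup>2 > 0\<close> by (intro divide_left_mono) auto
      then have "C * sqrt (hyp_metric z (y - x) (y - x)) \<le> \<bar>C\<bar> * (2 * norm (y - x) / (1 - r\<^sup>2))"
        unfolding hyp_norm[OF zD] using disc_pos[OF zD]
        by (intro mult_mono abs_ge_self divide_nonneg_pos) auto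
      then have "sqrt (g z (y - x) (y - x)) \<le> \<bar>C\<bar> * (2 * norm (y - x) / (1 - r\<^sup>2))"
        using upper[OF zD, of "y - x"] by linarith
      then show ?thesis by (metis nonneg[OF zD] real_sqrt_ge_0_iff real_sqrt_pow2 power_mono)
    qed
    moreover have "closed_segment x y \<subseteq> hyp_plane" using seg r by auto
    ultimately show ?thesis
      using linepath_admissible[OF g, of x y "\<bar>C\<bar> * (2 * norm (y - x) / (1 - r\<^sup>2))"]
        \<open>1 - r\<^sup>2 > 0\<close> by simp
  qed
  \<comment> \<open>Some admissible path must exist before a lower bound on lengths can pass to the
    infimum.\<close>
  have seg: "linepath x y \<in> ?P x y \<and> (\<exists>M. riemannian_length g (linepath x y) \<le> M * norm (y - x))"
    if "x \<in> hyp_plane" "y \<in> hyp_plane" for x y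
    using seg_upper[of "max (norm x) (norm y)" x y] that
    by (auto intro!: exI[of _ "\<bar>C\<bar> * (2 / (1 - (max (norm x) (norm y))\<^sup>2))"])
  have length_nonneg: "riemannian_length g \<gamma> \<ge> 0" if "\<gamma> \<in> ?P x y" for \<gamma> x y
    using that unfolding riemannian_length_def admissible_paths_def
    by (intro integral_nonneg) (auto simp: riemannian_speed_def path_image_def nonneg subset_iff)
  have bdd: "bdd_below (riemannian_length g ` ?P x y)" for x y
    using length_nonneg by (intro bdd_belowI[of _ 0]) auto
  have d_le: "?d x y \<le> riemannian_length g \<gamma>" if "x \<in> hyp_plane" "y \<in> hyp_plane" "\<gamma> \<in> ?P x y" for x y \<gamma>
    using that by (auto simp: riemannian_dist_eq intro!: cInf_lower bdd)
  have d_ge: "b \<le> ?d x y" if "x \<in> hyp_plane" "y \<in> hyp_plane"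
    "\<And>\<gamma>. \<gamma> \<in> ?P x y \<Longrightarrow> b \<le> riemannian_length g \<gamma>" for x y b
    using that seg[of x y] by (auto simp: riemannian_dist_eq intro!: cInf_greatest)
  have d_norm: "c * norm (y - x) \<le> ?d x y" if xy: "x \<in> hyp_plane" "y \<in> hyp_plane" for x y
  proof (rule d_ge[OF xy])
    fix \<gamma> assume "\<gamma> \<in> ?P x y"
    moreover have "c * norm u \<le> sqrt (g z u u)" if z: "z \<in> hyp_plane" for z u
    proof -
      have "norm u * (1 - (norm z)\<^sup>2) \<le> norm u * 2" 
        using zero_le_power2[of "norm z"] by (intro mult_left_mono) (linarith, simp)
      then have "norm u \<le> sqrt (hyp_metric z u u)"
        unfolding hyp_norm[OF z] using disc_pos[OF z] by (simp add: field_simps)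
      then show ?thesis using lower[OF z, of u] c by (meson mult_left_mono order_trans less_imp_le)
    qed
    ultimately show "c * norm (y - x) \<le> riemannian_length g \<gamma>"
      by (intro riemannian_length_lower_bound[of hyp_plane "\<lambda>z. z" "\<lambda>_ u. u" c g \<gamma>] c) auto
  qed
  \<comment> \<open>Up to a bounded error this is minus the hyperbolic distance to the origin. Its
    gradient has hyperbolic norm at most 1, and it tends to minus infinity at the boundary.\<close>
  let ?\<rho> = "\<lambda>z::complex. ln (1 - (norm z)\<^sup>2)"
  have d_\<rho>: "c * \<bar>?\<rho> y - ?\<rho> x\<bar> \<le> ?d x y" if xy: "x \<in> hyp_plane" "y \<in> hyp_plane" for x y
  proof (rule d_ge[OF xy])
    fix \<gamma> assume \<gamma>: "\<gamma> \<in> ?P x y"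
    let ?D = "\<lambda>z u. - 2 * (z \<bullet> u) / (1 - (norm z)\<^sup>2)"
    have 1: "(?\<rho> has_derivative ?D z) (at z)" if z: "z \<in> hyp_plane" for z
      using has_derivative_ln[OF disc_pos[OF z] one_minus_norm_has_derivative]
      by (simp add: divide_inverse)
    have 2: "c * norm (?D z u) \<le> sqrt (g z u u)" if z: "z \<in> hyp_plane" for z u
    proof -
      have "\<bar>z \<bullet> u\<bar> \<le> 1 * norm u"
        using Cauchy_Schwarz_ineq2[of z u] mult_right_mono[of "norm z" 1 "norm u"] z by auto
      then have "norm (?D z u) \<le> sqrt (hyp_metric z u u)"
        unfolding hyp_norm[OF z] using disc_pos[OF z] by (simp add: abs_mult divide_right_mono)
      then show ?thesis using lower[OF z, of u] c by (meson mult_left_mono order_trans less_imp_le)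
    qed
    show "c * \<bar>?\<rho> y - ?\<rho> x\<bar> \<le> riemannian_length g \<gamma>"
      using riemannian_length_lower_bound[OF 1 2 c \<gamma>] by simp
  qed
  have d_small: "?d x y \<le> \<bar>C\<bar> * (2 * norm (y - x) / (1 - r\<^sup>2))"
    if "r < 1" "x \<in> cball 0 r" "y \<in> cball 0 r" for x y r
    using seg_upper[OF that] d_le[of x y "linepath x y"] that by force
  interpret Metric_space hyp_plane ?d
  proof
    show "0 \<le> ?d x y" for x y
    proof (cases "x \<in> hyp_plane \<and> y \<in> hyp_plane")
      case True
      then show ?thesis using d_ge[of x y 0] length_nonneg by blast
    qed (auto simp: riemannian_dist_def)
    have le: "?d y x \<le> ?d x y" if "x \<in> hyp_plane" "y \<in> hyp_plane" for x y
      using admissible_paths_reverse[of hyp_plane g, OF neg] d_le that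
      by (intro d_ge) (simp_all, metis)
    show "?d x y = ?d y x" for x y
    proof (cases "x \<in> hyp_plane \<and> y \<in> hyp_plane")
      case True
      then show ?thesis using le[of x y] le[of y x] by simp
    qed (auto simp: riemannian_dist_def)
    show "?d x y = 0 \<longleftrightarrow> x = y" if xy: "x \<in> hyp_plane" "y \<in> hyp_plane" for x y
    proof
      assume "?d x y = 0"
      then have "c * norm (y - x) \<le> 0" using d_norm[OF xy] by simp
      then show "x = y" using c by (simp add: mult_le_0_iff)
    next
      assume "x = y"
      then have "?d x y \<le> 0" using d_small[of "norm x" x y] xy by simp
      moreover have "?d x y \<ge> 0" using d_ge[of x y 0] length_nonneg xy by blast
      ultimately show "?d x y = 0" by simp
    qed
    show "?d x w \<le> ?d x y + ?d y w" if "x \<in> hyp_plane" "y \<in> hyp_plane" "w \<in> hyp_plane" for x y w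
    proof -
      \<comment> \<open>The infimum is taken over the second path with the first one fixed, and then
        over the first.\<close>
      have "?d x w - riemannian_length g \<gamma>1 \<le> ?d y w" if "\<gamma>1 \<in> ?P x y" for \<gamma>1
      proof (rule d_ge)
        fix \<gamma>2 assume "\<gamma>2 \<in> ?P y w"
        then show "?d x w - riemannian_length g \<gamma>1 \<le> riemannian_length g \<gamma>2"
          using admissible_paths_join[of hyp_plane g, OF double \<open>\<gamma>1 \<in> ?P x y\<close>] d_le[of x w]
            \<open>x \<in> hyp_plane\<close> \<open>w \<in> hyp_plane\<close> by (metis diff_le_eq add.commute)
      qed fact+
      then have "?d x w - ?d y w \<le> ?d x y"
        by (intro d_ge) (use that in \<open>auto simp: algebra_simps\<close>)
      then show ?thesis by simp
    qed
  qed
  have "\<exists>l. limitin mtopology \<sigma> l sequentially" if \<sigma>: "MCauchy \<sigma>" for \<sigma>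
  proof -
    have D: "\<sigma> n \<in> hyp_plane" for n using \<sigma> unfolding MCauchy_def by blast
    have Cau: "\<exists>N. \<forall>n\<ge>N. \<forall>n'\<ge>N. ?d (\<sigma> n) (\<sigma> n') < e" if "e > 0" for e
      using \<sigma> that unfolding MCauchy_def by meson
    have "Cauchy \<sigma>"
    proof (rule metric_CauchyI)
      fix e :: real assume "e > 0"
      then obtain N where N: "\<And>n n'. n \<ge> N \<Longrightarrow> n' \<ge> N \<Longrightarrow> ?d (\<sigma> n) (\<sigma> n') < c * e"
        using Cau[of "c * e"] c by (metis mult_pos_pos)
      have "dist (\<sigma> n) (\<sigma> n') < e" if "n \<ge> N" "n' \<ge> N" for n n'
      proof -
        have "c * norm (\<sigma> n' - \<sigma> n) < c * e"
          using d_norm[OF D[of n] D[of n']] N[OF that] by linarith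
        then show ?thesis using c by (simp add: dist_norm norm_minus_commute)
      qed
      then show "\<exists>N. \<forall>m\<ge>N. \<forall>n\<ge>N. dist (\<sigma> m) (\<sigma> n) < e" by blast
    qed
    then obtain l where l: "\<sigma> \<longlonglongrightarrow> l" using Cauchy_convergent convergent_def by blast
    \<comment> \<open>Distances below \<open>c\<close> let \<open>?\<rho>\<close> change by less
      than 1 along the tail; \<open>r\<close> is the radius at which \<open>?\<rho>\<close> equals
      its value at \<open>\<sigma> N\<close> minus 1.\<close>
    obtain N where N: "\<And>n. n \<ge> N \<Longrightarrow> ?d (\<sigma> N) (\<sigma> n) < c" using Cau[OF c] by blast
    define r where "r = sqrt (1 - exp (?\<rho> (\<sigma> N) - 1))"
    have e1: "exp (?\<rho> (\<sigma> N) - 1) \<le> 1 - (norm (\<sigma> n))\<^sup>2" if "n \<ge> N" for n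
    proof -
      have "c * \<bar>?\<rho> (\<sigma> n) - ?\<rho> (\<sigma> N)\<bar> < c * 1" using d_\<rho>[OF D[of N] D[of n]] N[OF that] by simp
      then have "?\<rho> (\<sigma> N) - 1 \<le> ?\<rho> (\<sigma> n)" using c by (simp only: mult_less_cancel_left_pos)
      then show ?thesis using disc_pos[OF D[of n]] by (metis exp_le_cancel_iff exp_ln)
    qed
    have r: "r < 1" by (simp add: r_def)
    have inr: "\<sigma> n \<in> cball 0 r" if "n \<ge> N" for n
      using e1[OF that] by (simp add: r_def real_le_rsqrt)
    have r2: "r\<^sup>2 < 1"
      using r inr[of N] order_trans[OF norm_ge_zero, of "\<sigma> N" r] by (simp add: abs_square_less_1)
    have lr: "l \<in> cball 0 r"
      using l inr by (intro Lim_in_closed_set[of "cball 0 r" \<sigma> sequentially])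
        (auto simp: eventually_sequentially)
    have lD: "l \<in> hyp_plane" using lr r by simp
    have "(\<lambda>n. \<bar>C\<bar> * (2 * norm (l - \<sigma> n) / (1 - r\<^sup>2))) \<longlonglongrightarrow> \<bar>C\<bar> * (2 * norm (l - l) / (1 - r\<^sup>2))"
      using r2 by (intro tendsto_intros l) auto
    then have lim: "(\<lambda>n. \<bar>C\<bar> * (2 * norm (l - \<sigma> n) / (1 - r\<^sup>2))) \<longlonglongrightarrow> 0" by simp
    have "limitin mtopology \<sigma> l sequentially"
      unfolding limitin_metric
    proof (intro conjI allI impI lD)
      fix e :: real assume "e > 0"
      from order_tendstoD(2)[OF lim this]
      show "\<forall>\<^sub>F n in sequentially. \<sigma> n \<in> hyp_plane \<and> ?d (\<sigma> n) l < e"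
        using eventually_ge_at_top[of N]
        by eventually_elim (use D d_small[OF r inr lr] in \<open>force intro: le_less_trans\<close>)
    qed
    then show ?thesis by blast
  qed
  then show ?thesis
    unfolding complete_metric_def mcomplete_def by (simp add: Metric_space_axioms)
qed

section \<open>The twisted fields\<close>

text \<open>The identity field recovers the hyperbolic metric itself, so its Christoffel map is a
  special case of the general formula.\<close>

interpretation conformal: codazzi_field "\<lambda>_ v. v"
  by standard (auto simp: linear_id smooth_on_const plane_det_def hyp_cov_def)

lemma conformal_G: "conformal.G = hyp_metric"
  by (simp add: fun_eq_iff conformal.G_def)

lemma christoffel_hyp_metric:
  "z \<in> hyp_plane \<Longrightarrow> christoffel hyp_metric z u v = hyp_coeff z * u * v"
  using conformal.B_christoffel[of z u v]
  by (simp add: conformal_G conformal.T_def hyp_cov_def)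

lemma covariant_derivative_hyp_metric:
  "z \<in> hyp_plane \<Longrightarrow> covariant_derivative hyp_metric X Y z = hyp_cov Y z (X z)"
  by (simp add: covariant_derivative_def christoffel_hyp_metric hyp_cov_def)

lemma associated_morphism_codazzi_field:
  assumes "associated_morphism m b"
  shows "codazzi_field b"
proof (rule codazzi_field.intro)
  fix z u v :: complex assume z: "z \<in> hyp_plane"
  show lin: "linear (b z)" and "plane_det (b z) = 1"
    using assms z by (auto simp: associated_morphism_def)
  have "codazzi hyp_plane hyp_metric b" using assms by (simp add: associated_morphism_def)
  then have "covariant_derivative hyp_metric (\<lambda>_. u) (\<lambda>y. b y v) z
      - covariant_derivative hyp_metric (\<lambda>_. v) (\<lambda>y. b y u) z
      - b z (lie_bracket (\<lambda>_. u) (\<lambda>_. v) z) = 0"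
    unfolding codazzi_def using smooth_on_const z by blast
  then show "hyp_cov (\<lambda>y. b y v) z u = hyp_cov (\<lambda>y. b y u) z v"
    by (simp add: covariant_derivative_hyp_metric[OF z] lie_bracket_def linear_0[OF lin])
qed (use assms in \<open>auto simp: associated_morphism_def\<close>)

text \<open>For a conformal metric, self-adjointness means a symmetric matrix, that is, equal
  off-diagonal entries in the basis 1, \<open>\<i>\<close>.\<close>

locale symmetric_codazzi_field = codazzi_field b for b +
  assumes symmetric_b: "z \<in> hyp_plane \<Longrightarrow> Im (b z 1) = Re (b z \<i>)"
begin

lemma det_entries: "z \<in> hyp_plane \<Longrightarrow> Re (b z 1) * Im (b z \<i>) = 1 + (Re (b z \<i>))\<^sup>2"
  using det_B[of z] by (simp add: plane_det_def symmetric_b power2_eq_square)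

lemma b_entries:
  assumes "z \<in> hyp_plane"
  shows "Re (b z v) = Re (b z 1) * Re v + Re (b z \<i>) * Im v"
    and "Im (b z v) = Re (b z \<i>) * Re v + Im (b z \<i>) * Im v"
proof -
  show "Re (b z v) = Re (b z 1) * Re v + Re (b z \<i>) * Im v"
    by (subst B_expand[OF assms]) simp
  show "Im (b z v) = Re (b z \<i>) * Re v + Im (b z \<i>) * Im v"
    by (subst B_expand[OF assms]) (simp add: symmetric_b[OF assms])
qed

lemma hyp_cov_beta:
  assumes z: "z \<in> hyp_plane"
  shows "hyp_cov (\<lambda>y. beta b \<theta> y v) z u =
    cos (\<theta> / 2) *\<^sub>R (hyp_coeff z * u * v) + sin (\<theta> / 2) *\<^sub>R (\<i> * T z u v)"
proof -
  have "((\<lambda>y. beta b \<theta> y v) has_derivative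
      (\<lambda>u. 0 + sin (\<theta> / 2) *\<^sub>R (\<i> * frechet_derivative (\<lambda>y. b y v) (at z) u))) (at z)"
    unfolding beta_def
    by (intro has_derivative_add has_derivative_const has_derivative_scaleR_right
        has_derivative_mult_right B_has_derivative[OF z])
  then show ?thesis
    by (simp add: hyp_cov_def T_def frechet_derivative_at[symmetric] beta_def algebra_simps)
qed

lemma codazzi_field_beta: "codazzi_field (beta b \<theta>)"
proof (rule codazzi_field.intro)
  let ?c = "cos (\<theta> / 2)" and ?s = "sin (\<theta> / 2)"
  show "smooth_on hyp_plane (\<lambda>z. beta b \<theta> z v)" for v
    unfolding beta_def
    by (intro smooth_on_add smooth_on_const open_ball smooth_B
        smooth_on_bounded_linear[OF bounded_linear_scaleR_right]
        smooth_on_bounded_linear[OF bounded_linear_mult_right])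
  fix z u v :: complex assume z: "z \<in> hyp_plane"
  show "linear (beta b \<theta> z)"
    unfolding beta_def using linear_B[OF z]
    by (auto intro!: linearI simp: linear_add linear_cmul algebra_simps)
  \<comment> \<open>The mixed term is \<open>?c * ?s\<close> times the trace of \<open>Jb\<close>,
    which vanishes because \<open>b\<close> is symmetric.\<close>
  have "plane_det (beta b \<theta> z) = ?c\<^sup>2 + ?s\<^sup>2 * plane_det (b z)"
    unfolding plane_det_def beta_def
    by (simp add: symmetric_b[OF z] power2_eq_square algebra_simps)
  then show "plane_det (beta b \<theta> z) = 1" by (simp add: det_B[OF z])
  show "hyp_cov (\<lambda>y. beta b \<theta> y v) z u = hyp_cov (\<lambda>y. beta b \<theta> y u) z v"
    unfolding hyp_cov_beta[OF z] T_commute[OF z, of u v] by (simp add: mult.commute mult.left_commute)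
qed

lemma twisted_metric_eq: "twisted_metric b \<theta> = codazzi_field.G (beta b \<theta>)"
  by (simp add: fun_eq_iff twisted_metric_def codazzi_field.G_def[OF codazzi_field_beta])

text \<open>Adding \<open>pi\<close> to the angle turns the coefficient pair (c, s) into (-s, c). In
  the sum the mixed terms cancel and the squares add up to 1.\<close>

lemma twisted_metric_sum:
  assumes "z \<in> hyp_plane"
  shows "twisted_metric b \<theta> z u v + twisted_metric b (\<theta> + pi) z u v =
    hyp_metric z u v + hyp_metric z (b z u) (b z v)"
proof -
  let ?c = "cos (\<theta> / 2)" and ?s = "sin (\<theta> / 2)"
  have cs: "cos ((\<theta> + pi) / 2) = - ?s" "sin ((\<theta> + pi) / 2) = ?c"
    by (simp_all add: add_divide_distrib cos_add sin_add)
  have "(c *\<^sub>R u + s *\<^sub>R (\<i> * u')) \<bullet> (c *\<^sub>R v + s *\<^sub>R (\<i> * v')) +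
      ((- s) *\<^sub>R u + c *\<^sub>R (\<i> * u')) \<bullet> ((- s) *\<^sub>R v + c *\<^sub>R (\<i> * v')) =
      (c\<^sup>2 + s\<^sup>2) * (u \<bullet> v + u' \<bullet> v')" for c s and u' v' :: complex
    unfolding inner_complex_def by (simp add: power2_eq_square algebra_simps)
  from this[of ?c ?s "b z u" "b z v"]
  have "beta b \<theta> z u \<bullet> beta b \<theta> z v + beta b (\<theta> + pi) z u \<bullet> beta b (\<theta> + pi) z v =
      u \<bullet> v + b z u \<bullet> b z v"
    unfolding beta_def cs by simp
  then show ?thesis unfolding twisted_metric_def hyp_metric_eq by (simp flip: distrib_left)
qed

text \<open>The number \<open>\<delta> - \<alpha> - 2\<i>\<beta>\<close> is the contraction of \<open>uv\<close> with the adjugate of \<open>b\<close>, so the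
  covariant derivative of \<open>b\<close>, contracted with \<open>b\<inverse>\<close>, vanishes: by the Codazzi equation this
  contraction is the differential of \<open>ln (det b)\<close>.\<close>

lemma T_adjugate_trace:
  assumes z: "z \<in> hyp_plane"
  defines "\<alpha> \<equiv> Re (b z 1)" and "\<beta> \<equiv> Re (b z \<i>)" and "\<delta> \<equiv> Im (b z \<i>)"
  shows "\<delta> *\<^sub>R T z 1 1 - \<beta> *\<^sub>R (T z 1 \<i> + T z \<i> 1) + \<alpha> *\<^sub>R T z \<i> \<i> =
    b z (hyp_coeff z * Complex (\<delta> - \<alpha>) (- 2 * \<beta>))"
proof -
  let ?D = "\<lambda>v u. frechet_derivative (\<lambda>y. b y v) (at z) u"
  have D: "((\<lambda>y. b y v) has_derivative ?D v) (at z)" for v by (rule B_has_derivative[OF z])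
  have sym: "Im (?D 1 u) = Re (?D \<i> u)" for u
  proof -
    have "((\<lambda>y. Im (b y 1)) has_derivative (\<lambda>u. Re (?D \<i> u))) (at z)"
      by (rule has_derivative_transform_within_open[OF has_derivative_Re[OF D] open_ball z])
         (simp add: symmetric_b)
    from has_derivative_unique[OF this has_derivative_Im[OF D]] show ?thesis by metis
  qed
  have det: "\<alpha> * Im (?D \<i> u) + Re (?D 1 u) * \<delta> = 2 * \<beta> * Re (?D \<i> u)" for u
  proof -
    have "((\<lambda>y. Re (b y 1) * Im (b y \<i>) - Re (b y \<i>) * Re (b y \<i>)) has_derivative
        (\<lambda>u. \<alpha> * Im (?D \<i> u) + Re (?D 1 u) * \<delta> - (\<beta> * Re (?D \<i> u) + Re (?D \<i> u) * \<beta>))) (at z)"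
      unfolding \<alpha>_def \<beta>_def \<delta>_def
      by (intro has_derivative_diff has_derivative_mult has_derivative_Re has_derivative_Im D)
    moreover have "((\<lambda>y. Re (b y 1) * Im (b y \<i>) - Re (b y \<i>) * Re (b y \<i>)) has_derivative (\<lambda>_. 0)) (at z)"
      by (rule has_derivative_transform_within_open[OF has_derivative_const[of 1] open_ball z])
         (simp add: det_entries power2_eq_square)
    ultimately show ?thesis using has_derivative_unique by (fastforce dest: fun_cong[of _ _ u])
  qed
  \<comment> \<open>Codazzi exchanges the direction of differentiation with the column of
    \<open>b\<close>. The contraction thereby becomes the derivative of the determinant, along 1 in
    its real part and along \<open>\<i>\<close> in its imaginary part.\<close>
  have "?D \<i> 1 + hyp_coeff z * b z \<i> = ?D 1 \<i> + hyp_coeff z * \<i> * b z 1"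
    using T_commute[OF z, of 1 \<i>] by (simp add: T_def hyp_cov_def)
  then have cod: "Re (?D \<i> 1) = Re (?D 1 \<i>) - 2 * \<beta> * Re (hyp_coeff z) - (\<alpha> - \<delta>) * Im (hyp_coeff z)"
    "Im (?D \<i> 1) = Re (?D \<i> \<i>) - 2 * \<beta> * Im (hyp_coeff z) + (\<alpha> - \<delta>) * Re (hyp_coeff z)"
    unfolding \<alpha>_def \<beta>_def \<delta>_def
    by (auto simp: complex_eq_iff sym symmetric_b[OF z] algebra_simps)
  note entries = \<alpha>_def[symmetric] \<beta>_def[symmetric] \<delta>_def[symmetric] symmetric_b[OF z]
  show ?thesis
  proof (rule complex_eqI)
    show "Re (\<delta> *\<^sub>R T z 1 1 - \<beta> *\<^sub>R (T z 1 \<i> + T z \<i> 1) + \<alpha> *\<^sub>R T z \<i> \<i>) =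
        Re (b z (hyp_coeff z * Complex (\<delta> - \<alpha>) (- 2 * \<beta>)))"
      using det[of 1] unfolding b_entries(1)[OF z, of "_ * _"] T_def hyp_cov_def
      by (simp add: entries sym cod) algebra
    show "Im (\<delta> *\<^sub>R T z 1 1 - \<beta> *\<^sub>R (T z 1 \<i> + T z \<i> 1) + \<alpha> *\<^sub>R T z \<i> \<i>) =
        Im (b z (hyp_coeff z * Complex (\<delta> - \<alpha>) (- 2 * \<beta>)))"
      using det[of \<i>] unfolding b_entries(2)[OF z, of "_ * _"] T_def hyp_cov_def
      by (simp add: entries sym cod) algebra
  qed
qed

text \<open>The two arguments are the columns of the adjugate, which inverts a matrix of determinant
  one.\<close>

lemma b_adjugate:
  assumes z: "z \<in> hyp_plane"
  shows "b z (Complex (Im (b z \<i>)) (- Re (b z \<i>))) = 1"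
    and "b z (Complex (- Re (b z \<i>)) (Re (b z 1))) = \<i>"
  using det_entries[OF z]
  by (simp_all add: complex_eq_iff b_entries[OF z, of "Complex _ _"] power2_eq_square mult.commute)

text \<open>A symmetric matrix of trace zero has nonpositive determinant. The factor
  \<open>tr(b)\<close> can therefore be cancelled.\<close>

lemma trace_nonzero:
  assumes z: "z \<in> hyp_plane"
  shows "Re (b z 1) + Im (b z \<i>) \<noteq> 0"
proof
  assume "Re (b z 1) + Im (b z \<i>) = 0"
  then have "Im (b z \<i>) = - Re (b z 1)" by simp
  with det_entries[OF z] have "- (Re (b z 1))\<^sup>2 = 1 + (Re (b z \<i>))\<^sup>2" by (simp add: power2_eq_square)
  then show False using zero_le_power2[of "Re (b z 1)"] zero_le_power2[of "Re (b z \<i>)"] by linarith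
qed

text \<open>By Cayley--Hamilton the metric \<open>h = g + g(b\<cdot>,b\<cdot>)\<close> is \<open>tr(b) g(b\<cdot>,\<cdot>)\<close>, so contracting
  with the inverse of \<open>h\<close> amounts to contracting with the adjugate of \<open>b\<close>.\<close>

lemma T_orthonormal_trace:
  assumes z: "z \<in> hyp_plane"
    and expand: "\<And>v. v = h v e1 *\<^sub>R e1 + h v e2 *\<^sub>R e2"
    and h: "\<And>u v. h u v = hyp_metric z u v + hyp_metric z (b z u) (b z v)"
  shows "T z e1 e1 + T z e2 e2 = b z (hyp_coeff z * (e1\<^sup>2 + e2\<^sup>2))"
proof -
  define \<alpha> \<beta> \<delta> where abd: "\<alpha> = Re (b z 1)" "\<beta> = Re (b z \<i>)" "\<delta> = Im (b z \<i>)"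
  define l where "l = hyp_factor z * (\<alpha> + \<delta>)"
  have l: "l \<noteq> 0" using trace_nonzero[OF z] hyp_factor_pos[OF z] by (simp add: l_def abd)
  have "h (Complex \<delta> (- \<beta>)) e = l * Re e" "h (Complex (- \<beta>) \<alpha>) e = l * Im e" for e
    unfolding h hyp_metric_eq using b_adjugate[OF z] b_entries[OF z, of e]
    by (simp_all add: abd l_def inner_complex_def algebra_simps)
  \<comment> \<open>Expanding the adjugate columns in the frame writes the adjugate of
    \<open>b\<close> as \<open>l\<close> times the sum of the squares of \<open>e1\<close> and
    \<open>e2\<close> as rank-one matrices; the entries are read off in
    \<open>contr\<close>.\<close>
  with expand[of "Complex \<delta> (- \<beta>)"] expand[of "Complex (- \<beta>) \<alpha>"]
  have ex: "Complex \<delta> (- \<beta>) = l *\<^sub>R (Re e1 *\<^sub>R e1 + Re e2 *\<^sub>R e2)"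
    "Complex (- \<beta>) \<alpha> = l *\<^sub>R (Im e1 *\<^sub>R e1 + Im e2 *\<^sub>R e2)"
    by (simp_all add: scaleR_add_right)
  have contr: "\<delta> = l * ((Re e1)\<^sup>2 + (Re e2)\<^sup>2)" "- \<beta> = l * (Re e1 * Im e1 + Re e2 * Im e2)"
    "\<alpha> = l * ((Im e1)\<^sup>2 + (Im e2)\<^sup>2)"
    using ex by (simp_all add: complex_eq_iff power2_eq_square)
  have "l *\<^sub>R (T z e1 e1 + T z e2 e2) =
      (l * ((Re e1)\<^sup>2 + (Re e2)\<^sup>2)) *\<^sub>R T z 1 1
      + (l * (Re e1 * Im e1 + Re e2 * Im e2)) *\<^sub>R (T z 1 \<i> + T z \<i> 1)
      + (l * ((Im e1)\<^sup>2 + (Im e2)\<^sup>2)) *\<^sub>R T z \<i> \<i>"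
    unfolding T_expand[OF z, of e1 e1] T_expand[OF z, of e2 e2]
    by (simp add: algebra_simps power2_eq_square)
  also have "\<dots> = b z (hyp_coeff z * Complex (\<delta> - \<alpha>) (- 2 * \<beta>))"
    using T_adjugate_trace[OF z] by (simp flip: contr abd)
  also have "Complex (\<delta> - \<alpha>) (- 2 * \<beta>) = l *\<^sub>R (e1\<^sup>2 + e2\<^sup>2)"
    using contr by (simp add: complex_eq_iff power2_eq_square algebra_simps)
  also have "b z (hyp_coeff z * (l *\<^sub>R (e1\<^sup>2 + e2\<^sup>2))) = l *\<^sub>R b z (hyp_coeff z * (e1\<^sup>2 + e2\<^sup>2))"
    by (simp add: linear_cmul[OF linear_B[OF z]])
  finally show ?thesis using l by simp
qed

text \<open>The untwisted part and the \<open>Jb\<close> part of \<open>beta\<close> both send the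
  same vector to their share of the trace. That vector is the trace of the hyperbolic Christoffel
  map, and \<open>beta\<close> is injective.\<close>

lemma christoffel_twisted_trace:
  assumes z: "z \<in> hyp_plane"
    and expand: "\<And>v. v = h v e1 *\<^sub>R e1 + h v e2 *\<^sub>R e2"
    and h: "\<And>u v. h u v = hyp_metric z u v + hyp_metric z (b z u) (b z v)"
  shows "christoffel (twisted_metric b \<theta>) z e1 e1 + christoffel (twisted_metric b \<theta>) z e2 e2 =
    hyp_coeff z * (e1\<^sup>2 + e2\<^sup>2)"
proof -
  interpret \<beta>: codazzi_field "beta b \<theta>" by (rule codazzi_field_beta)
  have "beta b \<theta> z (christoffel \<beta>.G z e1 e1 + christoffel \<beta>.G z e2 e2) = \<beta>.T z e1 e1 + \<beta>.T z e2 e2"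
    by (simp add: linear_add[OF \<beta>.linear_B[OF z]] \<beta>.B_christoffel[OF z])
  also have "\<dots> = cos (\<theta> / 2) *\<^sub>R (hyp_coeff z * (e1\<^sup>2 + e2\<^sup>2)) +
      sin (\<theta> / 2) *\<^sub>R (\<i> * (T z e1 e1 + T z e2 e2))"
    by (simp add: \<beta>.T_def hyp_cov_beta[OF z] algebra_simps power2_eq_square)
  also have "\<dots> = beta b \<theta> z (hyp_coeff z * (e1\<^sup>2 + e2\<^sup>2))"
    by (simp add: T_orthonormal_trace[OF z expand h] beta_def)
  finally show ?thesis by (simp add: \<beta>.B_inj[OF z] twisted_metric_eq)
qed

end

section \<open>The diagonal immersion\<close>

text \<open>Pairing with \<open>e1\<close> and \<open>e2\<close> recovers the coordinates, so
  \<open>?L\<close> is injective and, by dimension, surjective.\<close>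

lemma orthonormal_expand:
  fixes h :: "complex \<Rightarrow> complex \<Rightarrow> real"
  assumes h: "bilinear h" "\<And>u v. h u v = h v u" and on: "h e1 e1 = 1" "h e2 e2 = 1" "h e1 e2 = 0"
  shows "v = h v e1 *\<^sub>R e1 + h v e2 *\<^sub>R e2"
proof -
  let ?L = "\<lambda>w. Re w *\<^sub>R e1 + Im w *\<^sub>R e2"
  have lin: "linear ?L" by (auto intro!: linearI simp: algebra_simps)
  have coord: "h (?L w) e1 = Re w" "h (?L w) e2 = Im w" for w
    using on h(2)[of e1 e2] by (simp_all add: bilinear_ladd[OF h(1)] bilinear_lmul[OF h(1)])
  have "inj ?L" by (intro injI complex_eqI) (metis coord)+
  then obtain w where "v = ?L w" using linear_injective_imp_surjective[OF lin] by blast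
  then show ?thesis using coord[of w] by simp
qed

lemma frechet_derivative_product_metric:
  assumes "(\<lambda>y. g1 y (fst V) (fst W)) differentiable (at a)"
    and "(\<lambda>y. g2 y (snd V) (snd W)) differentiable (at c)"
  shows "frechet_derivative (\<lambda>p. product_metric g1 g2 p V W) (at (a, c)) U =
    frechet_derivative (\<lambda>y. g1 y (fst V) (fst W)) (at a) (fst U) +
    frechet_derivative (\<lambda>y. g2 y (snd V) (snd W)) (at c) (snd U)"
proof -
  have 1: "((\<lambda>y. g1 y (fst V) (fst W)) has_derivative
      frechet_derivative (\<lambda>y. g1 y (fst V) (fst W)) (at a)) (at (fst (a, c)))"
    and 2: "((\<lambda>y. g2 y (snd V) (snd W)) has_derivative
      frechet_derivative (\<lambda>y. g2 y (snd V) (snd W)) (at c)) (at (snd (a, c)))"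
    using assms by (simp_all add: frechet_derivative_works)
  have "((\<lambda>p. g1 (fst p) (fst V) (fst W) + g2 (snd p) (snd V) (snd W)) has_derivative
      (\<lambda>U. frechet_derivative (\<lambda>y. g1 y (fst V) (fst W)) (at a) (fst U) +
        frechet_derivative (\<lambda>y. g2 y (snd V) (snd W)) (at c) (snd U))) (at (a, c))"
    using has_derivative_add[OF
        diff_chain_at[OF has_derivative_fst[OF has_derivative_ident] 1]
        diff_chain_at[OF has_derivative_snd[OF has_derivative_ident] 2]]
    by (simp add: o_def)
  then show ?thesis by (simp add: product_metric_def frechet_derivative_at[symmetric])
qed

text \<open>Each summand of the metric depends on one factor only, so the Koszul formula splits;
  \<open>x1\<close> and \<open>x2\<close> stand for solutions in the two factors.\<close>

lemma christoffel_product_metric: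
  assumes g1: "bilinear (g1 a)" "\<And>x. x \<noteq> 0 \<Longrightarrow> g1 a x x > 0" "\<And>v w. (\<lambda>y. g1 y v w) differentiable (at a)"
    and g2: "bilinear (g2 c)" "\<And>x. x \<noteq> 0 \<Longrightarrow> g2 c x x > 0" "\<And>v w. (\<lambda>y. g2 y v w) differentiable (at c)"
    and k1: "\<And>w. 2 * g1 a x1 w = frechet_derivative (\<lambda>y. g1 y v1 w) (at a) u1
      + frechet_derivative (\<lambda>y. g1 y u1 w) (at a) v1 - frechet_derivative (\<lambda>y. g1 y u1 v1) (at a) w"
    and k2: "\<And>w. 2 * g2 c x2 w = frechet_derivative (\<lambda>y. g2 y v2 w) (at c) u2
      + frechet_derivative (\<lambda>y. g2 y u2 w) (at c) v2 - frechet_derivative (\<lambda>y. g2 y u2 v2) (at c) w"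
  shows "christoffel (product_metric g1 g2) (a, c) (u1, u2) (v1, v2) = (x1, x2)"
proof (rule christoffel_eqI[where g = "product_metric g1 g2"])
  show "bilinear (product_metric g1 g2 (a, c))"
    unfolding bilinear_def product_metric_def
    by (auto intro!: linearI simp: bilinear_ladd[OF g1(1)] bilinear_radd[OF g1(1)]
        bilinear_lmul[OF g1(1)] bilinear_rmul[OF g1(1)] bilinear_ladd[OF g2(1)] bilinear_radd[OF g2(1)]
        bilinear_lmul[OF g2(1)] bilinear_rmul[OF g2(1)] algebra_simps)
  show "product_metric g1 g2 (a, c) x x \<noteq> 0" if "x \<noteq> 0" for x
  proof -
    have "g1 a (fst x) (fst x) \<ge> 0" "g2 c (snd x) (snd x) \<ge> 0"
      using g1(2)[of "fst x"] g2(2)[of "snd x"] bilinear_lzero[OF g1(1)] bilinear_lzero[OF g2(1)]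
      by (metis less_eq_real_def)+
    moreover have "fst x \<noteq> 0 \<or> snd x \<noteq> 0" using that by (auto simp: prod_eq_iff)
    ultimately show ?thesis
      using g1(2)[of "fst x"] g2(2)[of "snd x"] unfolding product_metric_def by force
  qed
  show "2 * product_metric g1 g2 (a, c) (x1, x2) w =
      frechet_derivative (\<lambda>y. product_metric g1 g2 y (v1, v2) w) (at (a, c)) (u1, u2)
    + frechet_derivative (\<lambda>y. product_metric g1 g2 y (u1, u2) w) (at (a, c)) (v1, v2)
    - frechet_derivative (\<lambda>y. product_metric g1 g2 y (u1, u2) (v1, v2)) (at (a, c)) w" for w
    using k1[of "fst w"] k2[of "snd w"]
    by (simp add: frechet_derivative_product_metric g1(3) g2(3)) (simp add: product_metric_def)
qed

text \<open>The second fundamental form is the normal part of the pair of Christoffel maps. If their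
  traces for the induced metric \<open>g1 + g2\<close> agree, the traced pair has the form (w, w),
  which is tangent to the diagonal, and the mean curvature vanishes.\<close>

lemma minimal_immersion_diagonal:
  fixes g1 g2 :: "complex metric_field"
  assumes g1: "riemannian_metric S g1" and g2: "riemannian_metric S g2"
    and k1: "\<And>z u v w. z \<in> S \<Longrightarrow> 2 * g1 z (\<Gamma> z u v) w = frechet_derivative (\<lambda>y. g1 y v w) (at z) u
      + frechet_derivative (\<lambda>y. g1 y u w) (at z) v - frechet_derivative (\<lambda>y. g1 y u v) (at z) w"
    and k2: "\<And>z u v w. z \<in> S \<Longrightarrow> 2 * g2 z (\<Gamma>' z u v) w = frechet_derivative (\<lambda>y. g2 y v w) (at z) u
      + frechet_derivative (\<lambda>y. g2 y u w) (at z) v - frechet_derivative (\<lambda>y. g2 y u v) (at z) w"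
    and trace: "\<And>z e1 e2. z \<in> S \<Longrightarrow>
      (\<And>v. v = (g1 z v e1 + g2 z v e1) *\<^sub>R e1 + (g1 z v e2 + g2 z v e2) *\<^sub>R e2) \<Longrightarrow>
      \<Gamma> z e1 e1 + \<Gamma> z e2 e2 = \<Gamma>' z e1 e1 + \<Gamma>' z e2 e2"
  shows "minimal_immersion S (product_metric g1 g2) (\<lambda>z. (z, z))"
  unfolding minimal_immersion_def
proof (intro conjI ballI allI impI)
  let ?F = "\<lambda>z::complex. (z, z)" and ?G = "product_metric g1 g2"
  have dF: "frechet_derivative ?F (at z) = (\<lambda>u. (u, u))" for z
    by (rule frechet_derivative_at[symmetric]) (intro has_derivative_Pair has_derivative_ident)
  have S: "open S" using g1 by (simp add: riemannian_metric_def)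
  have "bounded_linear ?F" by (intro bounded_linear_Pair bounded_linear_ident)
  from smooth_on_bounded_linear[OF this S smooth_on_ident[OF S]] show "smooth_on S ?F" .
  fix z assume z: "z \<in> S"
  show "inj (frechet_derivative ?F (at z))" by (simp add: dF inj_on_def)
  fix e1 e2
  define h where "h = (\<lambda>u v. g1 z u v + g2 z u v)"
  have bil: "bilinear (g1 z)" "bilinear (g2 z)" and sym: "g1 z u v = g1 z v u" "g2 z u v = g2 z v u"
    and pos: "u \<noteq> 0 \<Longrightarrow> g1 z u u > 0" "u \<noteq> 0 \<Longrightarrow> g2 z u u > 0" for u v
    using g1 g2 z by (auto simp: riemannian_metric_def)
  have diff: "(\<lambda>y. g1 y v w) differentiable (at z)" "(\<lambda>y. g2 y v w) differentiable (at z)" for v w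
    using g1 g2 smooth_on_has_derivative[OF _ z, of "\<lambda>y. g1 y v w"]
      smooth_on_has_derivative[OF _ z, of "\<lambda>y. g2 y v w"]
    unfolding riemannian_metric_def differentiable_def by blast+
  note add = bilinear_ladd[OF bil(1)] bilinear_radd[OF bil(1)] bilinear_ladd[OF bil(2)] bilinear_radd[OF bil(2)]
  note scale = bilinear_lmul[OF bil(1)] bilinear_rmul[OF bil(1)] bilinear_lmul[OF bil(2)] bilinear_rmul[OF bil(2)]
  note diffs = bilinear_lsub[OF bil(1)] bilinear_lsub[OF bil(2)]
  have hbil: "bilinear h"
    unfolding bilinear_def h_def by (auto intro!: linearI simp: add scale algebra_simps)
  assume "pullback_metric ?F ?G z e1 e1 = 1 \<and> pullback_metric ?F ?G z e2 e2 = 1 \<and>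
    pullback_metric ?F ?G z e1 e2 = 0"
  then have "h e1 e1 = 1" "h e2 e2 = 1" "h e1 e2 = 0"
    by (auto simp: pullback_metric_def dF product_metric_def h_def)
  note expand = orthonormal_expand[OF hbil _ this]
  have hsym: "h u v = h v u" for u v using sym by (simp add: h_def)
  note expand = expand[OF hsym]
  \<comment> \<open>Orthogonal projection to the diagonal, written in the orthonormal frame: the
    tangential part of \<open>X\<close> is \<open>(t X, t X)\<close>.\<close>
  define t where "t = (\<lambda>X. (g1 z (fst X) e1 + g2 z (snd X) e1) *\<^sub>R e1 + (g1 z (fst X) e2 + g2 z (snd X) e2) *\<^sub>R e2)"
  have normal: "normal_part ?G ?F z X = X - (t X, t X)" for X
    unfolding normal_part_def dF
  proof (rule the_equality)
    show "(\<forall>w. ?G (z, z) (X - (t X, t X)) (w, w) = 0) \<and> X - (X - (t X, t X)) \<in> range (\<lambda>u. (u, u))"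
    proof (intro conjI allI)
      fix w
      have "g1 z (fst X) w + g2 z (snd X) w =
          g1 z (fst X) (h w e1 *\<^sub>R e1 + h w e2 *\<^sub>R e2) + g2 z (snd X) (h w e1 *\<^sub>R e1 + h w e2 *\<^sub>R e2)"
        by (simp flip: expand[of w])
      also have "\<dots> = (g1 z (fst X) e1 + g2 z (snd X) e1) * h e1 w + (g1 z (fst X) e2 + g2 z (snd X) e2) * h e2 w"
        by (simp add: add scale hsym[of w] algebra_simps)
      also have "\<dots> = h (t X) w"
        by (simp add: t_def bilinear_ladd[OF hbil] bilinear_lmul[OF hbil])
      finally show "?G (z, z) (X - (t X, t X)) (w, w) = 0"
        by (simp add: product_metric_def diffs h_def)
    qed simp
    fix n assume n: "(\<forall>w. ?G (z, z) n (w, w) = 0) \<and> X - n \<in> range (\<lambda>u. (u, u))"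
    then obtain d where d: "X - n = (d, d)" by blast
    then have Xn: "fst X = fst n + d" "snd X = snd n + d" by (auto simp: prod_eq_iff algebra_simps)
    have "g1 z (fst n) w + g2 z (snd n) w = 0" for w using n by (auto simp: product_metric_def)
    then have "t X = h d e1 *\<^sub>R e1 + h d e2 *\<^sub>R e2"
      unfolding t_def Xn add h_def by (smt (verit))
    then have "t X = d" by (simp flip: expand)
    then show "n = X - (t X, t X)" using d by (metis add_diff_cancel_left' diff_add_cancel)
  qed
  have II: "second_fundamental_form ?G ?F z u u = (\<Gamma> z u u, \<Gamma>' z u u) - (t (\<Gamma> z u u, \<Gamma>' z u u), t (\<Gamma> z u u, \<Gamma>' z u u))" for u
  proof -
    have "christoffel ?G (z, z) (u, u) (u, u) = (\<Gamma> z u u, \<Gamma>' z u u)"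
      by (rule christoffel_product_metric) (erule pos | rule bil diff k1[OF z] k2[OF z])+
    then show ?thesis
      unfolding second_fundamental_form_def dF frechet_derivative_const normal by simp
  qed
  have tr: "\<Gamma> z e1 e1 + \<Gamma> z e2 e2 = \<Gamma>' z e1 e1 + \<Gamma>' z e2 e2"
    by (rule trace[OF z]) (use expand in \<open>simp add: h_def\<close>)
  have "t (\<Gamma> z e1 e1, \<Gamma>' z e1 e1) + t (\<Gamma> z e2 e2, \<Gamma>' z e2 e2) =
     (g1 z (\<Gamma> z e1 e1 + \<Gamma> z e2 e2) e1 + g2 z (\<Gamma>' z e1 e1 + \<Gamma>' z e2 e2) e1) *\<^sub>R e1 +
     (g1 z (\<Gamma> z e1 e1 + \<Gamma> z e2 e2) e2 + g2 z (\<Gamma>' z e1 e1 + \<Gamma>' z e2 e2) e2) *\<^sub>R e2"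
    by (simp add: t_def add algebra_simps)
  also have "\<dots> = \<Gamma> z e1 e1 + \<Gamma> z e2 e2"
    unfolding tr[symmetric] using expand[of "\<Gamma> z e1 e1 + \<Gamma> z e2 e2"] by (simp add: h_def)
  finally show "second_fundamental_form ?G ?F z e1 e1 + second_fundamental_form ?G ?F z e2 e2 = 0"
    unfolding II using tr by (simp add: prod_eq_iff algebra_simps)
qed

context symmetric_codazzi_field
begin

lemma minimal_lagrangian_twisted:
  "minimal_lagrangian hyp_plane (twisted_metric b \<theta>) hyp_plane (twisted_metric b (\<theta> + pi)) (\<lambda>z. z)"
proof -
  interpret \<beta>: codazzi_field "beta b \<theta>" by (rule codazzi_field_beta)
  interpret \<beta>': codazzi_field "beta b (\<theta> + pi)" by (rule codazzi_field_beta)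
  \<comment> \<open>On the disc \<open>inv_into\<close> agrees with the identity, and smoothness on
    an open set depends only on the values there.\<close>
  have "smooth_on hyp_plane (inv_into hyp_plane (\<lambda>z. z))"
    by (rule smooth_on_cong[OF open_ball _ smooth_on_ident[OF open_ball]])
       (simp add: inv_into_f_eq[of "\<lambda>z. z"])
  then have "diffeo_on hyp_plane hyp_plane (\<lambda>z. z)"
    by (simp add: diffeo_on_def smooth_on_ident bij_betw_def)
  moreover have "area_orientation_preserving hyp_plane \<beta>.G \<beta>'.G (\<lambda>z. z)"
    by (simp add: area_orientation_preserving_def area_form_def \<beta>.G_det \<beta>'.G_det)
  moreover have "minimal_immersion hyp_plane (product_metric \<beta>.G \<beta>'.G) (\<lambda>z. (z, z))"
  proof (rule minimal_immersion_diagonal[OF \<beta>.riemannian_G \<beta>'.riemannian_G,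
        where \<Gamma> = "\<lambda>z u v. plane_inverse (beta b \<theta> z) (\<beta>.T z u v)"
          and \<Gamma>' = "\<lambda>z u v. plane_inverse (beta b (\<theta> + pi) z) (\<beta>'.T z u v)"])
    fix z e1 e2 assume z: "z \<in> hyp_plane"
      and expand: "\<And>v. v = (\<beta>.G z v e1 + \<beta>'.G z v e1) *\<^sub>R e1 + (\<beta>.G z v e2 + \<beta>'.G z v e2) *\<^sub>R e2"
    have h: "\<beta>.G z u v + \<beta>'.G z u v = hyp_metric z u v + hyp_metric z (b z u) (b z v)" for u v
      using twisted_metric_sum[OF z] by (simp add: twisted_metric_eq)
    show "plane_inverse (beta b \<theta> z) (\<beta>.T z e1 e1) + plane_inverse (beta b \<theta> z) (\<beta>.T z e2 e2) =
        plane_inverse (beta b (\<theta> + pi) z) (\<beta>'.T z e1 e1) + plane_inverse (beta b (\<theta> + pi) z) (\<beta>'.T z e2 e2)"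
      using christoffel_twisted_trace[OF z expand h, of \<theta>]
        christoffel_twisted_trace[OF z expand h, of "\<theta> + pi"]
      by (simp add: twisted_metric_eq \<beta>.christoffel_G[OF z] \<beta>'.christoffel_G[OF z])
  qed (rule \<beta>.G_koszul \<beta>'.G_koszul, assumption)+
  ultimately show ?thesis by (simp add: minimal_lagrangian_def twisted_metric_eq)
qed

text \<open>If \<open>b\<close> stretched some unit vector by more than \<open>K\<close>, it would stretch every vector, and so
  would \<open>b\<inverse> = -JbJ\<close>.\<close>

lemma b_bound:
  assumes z: "z \<in> hyp_plane" and K: "K \<ge> 1"
    and ratio: "\<And>u v. norm u = 1 \<Longrightarrow> norm v = 1 \<Longrightarrow> norm (b z u) \<le> K * norm (b z v)"
  shows "norm (b z v) \<le> K * norm v"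
proof -
  have scale: "norm (b z v) = norm v * norm (b z (sgn v))" for v
  proof -
    have "v = norm v *\<^sub>R sgn v" by (cases "v = 0") (simp_all add: sgn_div_norm)
    then have "b z v = norm v *\<^sub>R b z (sgn v)" using linear_cmul[OF linear_B[OF z]] by metis
    then show ?thesis by simp
  qed
  have "norm (b z u) \<le> K" if u: "norm u = 1" for u
  proof (rule ccontr)
    assume "\<not> norm (b z u) \<le> K"
    then have "1 * K < norm (b z v) * K" if "norm v = 1" for v
      using ratio[OF u that] by (simp add: mult.commute)
    then have big: "norm (b z v) > 1" if "norm v = 1" for v
      using K that by (metis less_le_trans mult_less_cancel_right_pos zero_less_one)
    have expand: "norm v < norm (b z v)" if "v \<noteq> 0" for v
      unfolding scale[of v] using big[of "sgn v"] that by (simp add: norm_sgn)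
    have b1: "1 < norm (b z 1)" using big by simp
    \<comment> \<open>For symmetric \<open>b\<close> of determinant one, \<open>bJb = J\<close>. So
      \<open>b\<close> maps the long vector \<open>\<i> * b z 1\<close> to a unit vector, although
      it was seen to lengthen every nonzero vector.\<close>
    have "b z (\<i> * b z 1) = \<i>"
      using det_entries[OF z]
      by (simp add: complex_eq_iff b_entries[OF z, of "\<i> * _"] symmetric_b[OF z] power2_eq_square)
         (simp add: algebra_simps)
    moreover have "\<i> * b z 1 \<noteq> 0" using b1 by auto
    ultimately have "norm (\<i> * b z 1) < 1" using expand[of "\<i> * b z 1"] by simp
    then show False using b1 by (simp add: norm_mult)
  qed
  then have "norm (b z (sgn v)) \<le> K" if "v \<noteq> 0" using that by (simp add: norm_sgn)
  then show ?thesis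
    using scale[of v] by (cases "v = 0") (simp_all add: mult.commute mult_left_mono)
qed

text \<open>The triangle inequality with cosine and sine at most 1 in modulus gives
  \<open>1 + K\<close>; the factor 2 comes from the inverse, and one constant then serves both
  directions.\<close>

lemma beta_bounds:
  assumes z: "z \<in> hyp_plane" and K: "K \<ge> 1" and b: "\<And>v. norm (b z v) \<le> K * norm v"
  shows "norm (beta b \<theta> z v) \<le> 2 * (1 + K) * norm v"
    and "norm v \<le> 2 * (1 + K) * norm (beta b \<theta> z v)"
proof -
  interpret \<beta>: codazzi_field "beta b \<theta>" by (rule codazzi_field_beta)
  have le: "norm (beta b \<theta> z v) \<le> (1 + K) * norm v" for v
  proof -
    have "norm (beta b \<theta> z v) \<le> \<bar>cos (\<theta> / 2)\<bar> * norm v + \<bar>sin (\<theta> / 2)\<bar> * norm (b z v)"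
      unfolding beta_def by (rule order_trans[OF norm_triangle_ineq]) (simp add: norm_mult)
    also have "\<dots> \<le> 1 * norm v + 1 * (K * norm v)"
      using b[of v] K by (intro add_mono mult_mono) auto
    finally show ?thesis by (simp add: algebra_simps)
  qed
  moreover have "(1 + K) * norm v \<le> 2 * (1 + K) * norm v" using K by (intro mult_right_mono) auto
  ultimately show "norm (beta b \<theta> z v) \<le> 2 * (1 + K) * norm v" by (meson order_trans)
  have "norm (plane_inverse (beta b \<theta> z) (beta b \<theta> z v)) \<le> 2 * (1 + K) * norm (beta b \<theta> z v)"
    using le[of 1] le[of \<i>] by (intro plane_inverse_bound) simp_all
  then show "norm v \<le> 2 * (1 + K) * norm (beta b \<theta> z v)"
    by (simp add: plane_inverse(2)[OF \<beta>.linear_B[OF z] \<beta>.det_B[OF z]])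
qed

end

theorem lemma8p3:
  fixes \<psi> m :: "complex \<Rightarrow> complex"
    and b :: "complex \<Rightarrow> complex \<Rightarrow> complex"
    and \<theta> :: real
  assumes "quasi_symmetric_homeo \<psi>"
    and "minimal_lagrangian hyp_plane hyp_metric hyp_plane hyp_metric m"
    and "quasi_conformal hyp_plane hyp_metric hyp_metric m"
    and "boundary_extension m \<psi>"
    and "associated_morphism m b"
  shows "hyperbolic_metric hyp_plane (twisted_metric b \<theta>) \<and>
         complete_metric hyp_plane (twisted_metric b \<theta>) \<and>
         hyperbolic_metric hyp_plane (twisted_metric b (\<theta> + pi)) \<and>
         complete_metric hyp_plane (twisted_metric b (\<theta> + pi)) \<and>
         minimal_lagrangian hyp_plane (twisted_metric b \<theta>)
           hyp_plane (twisted_metric b (\<theta> + pi)) (\<lambda>z. z) \<and>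
         quasi_conformal hyp_plane (twisted_metric b \<theta>) (twisted_metric b (\<theta> + pi)) (\<lambda>z. z)"
proof -
  interpret codazzi_field b by (rule associated_morphism_codazzi_field[OF assms(5)])
  interpret symmetric_codazzi_field b
  proof
    fix z assume z: "z \<in> hyp_plane"
    then have "hyp_metric z (b z 1) \<i> = hyp_metric z 1 (b z \<i>)"
      using assms(5) unfolding associated_morphism_def by blast
    then show "Im (b z 1) = Re (b z \<i>)"
      using hyp_factor_pos[OF z] by (simp add: hyp_metric_eq inner_complex_def)
  qed
  obtain K where K: "K \<ge> 1" and qc: "\<And>z u v. z \<in> hyp_plane \<Longrightarrow> hyp_metric z u u = 1 \<Longrightarrow>
      hyp_metric z v v = 1 \<Longrightarrow>
      sqrt (pullback_metric m hyp_metric z u u) \<le> K * sqrt (pullback_metric m hyp_metric z v v)"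
    using assms(3) unfolding quasi_conformal_def by blast
  have b: "norm (b z v) \<le> K * norm v" if z: "z \<in> hyp_plane" for z v
  proof (rule b_bound[OF z K])
    fix u v :: complex assume uv: "norm u = 1" "norm v = 1"
    let ?l = "sqrt (hyp_factor z)"
    have l: "?l > 0" "hyp_factor z = ?l * ?l" using hyp_factor_pos[OF z] by simp_all
    \<comment> \<open>Quasi-conformality speaks of hyperbolic unit vectors; dividing Euclidean ones
      by \<open>?l\<close> produces them, and the factor cancels against the one in the
      metric.\<close>
    have unit: "hyp_metric z (w /\<^sub>R ?l) (w /\<^sub>R ?l) = 1" if "norm w = 1" for w
      using l that by (simp add: hyp_metric_eq power_inverse flip: power2_norm_eq_inner)
    have "sqrt (pullback_metric m hyp_metric z (w /\<^sub>R ?l) (w /\<^sub>R ?l)) = norm (b z w)" for w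
    proof -
      have "pullback_metric m hyp_metric z x x = hyp_metric z (b z x) (b z x)" for x
        using assms(5) z unfolding associated_morphism_def by blast
      then show ?thesis
        using l by (simp add: sqrt_hyp_metric linear_cmul[OF linear_B[OF z]])
    qed
    then show "norm (b z u) \<le> K * norm (b z v)"
      using qc[OF z unit[OF uv(1)] unit[OF uv(2)]] by simp
  qed
  define M where "M = 2 * (1 + K)"
  have M: "M \<ge> 1" using K by (simp add: M_def)
  have bounds: "norm (beta b \<theta> z v) \<le> M * norm v" "norm v \<le> M * norm (beta b \<theta> z v)"
    if "z \<in> hyp_plane" for z v \<theta>
    using beta_bounds[OF that K b[OF that]] by (simp_all add: M_def)
  have speed: "sqrt (twisted_metric b \<theta> z u u) = sqrt (hyp_factor z) * norm (beta b \<theta> z u)" for \<theta> z u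
    by (simp add: twisted_metric_def sqrt_hyp_metric)
  have hyperbolic: "hyperbolic_metric hyp_plane (twisted_metric b \<theta>)" for \<theta>
    unfolding twisted_metric_eq by (rule codazzi_field.hyperbolic_G[OF codazzi_field_beta])
  have complete: "complete_metric hyp_plane (twisted_metric b \<theta>)" for \<theta>
  proof (rule complete_metric_bilipschitz_hyperbolic[where c = "1 / M" and C = M])
    show "riemannian_metric hyp_plane (twisted_metric b \<theta>)"
      using hyperbolic by (simp add: hyperbolic_metric_def)
    show "1 / M > 0" using M by simp
    fix z u assume z: "z \<in> hyp_plane"
    have l: "sqrt (hyp_factor z) > 0" using hyp_factor_pos[OF z] by simp
    show "1 / M * sqrt (hyp_metric z u u) \<le> sqrt (twisted_metric b \<theta> z u u)"
      using l M bounds(2)[OF z, of u \<theta>] by (simp add: speed sqrt_hyp_metric field_simps)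
    show "sqrt (twisted_metric b \<theta> z u u) \<le> M * sqrt (hyp_metric z u u)"
      using l bounds(1)[OF z, of \<theta> u] by (simp add: speed sqrt_hyp_metric)
  qed
  have "quasi_conformal hyp_plane (twisted_metric b \<theta>) (twisted_metric b (\<theta> + pi)) (\<lambda>z. z)"
    unfolding quasi_conformal_def
  \<comment> \<open>One factor \<open>M\<close> for each of four comparisons: from
    \<open>beta b (\<theta> + pi) z u\<close> to \<open>u\<close>, to its equally long partners
    under \<open>beta b \<theta> z\<close>, to \<open>v\<close>, and to
    \<open>beta b (\<theta> + pi) z v\<close>.\<close>
  proof (intro exI[of _ "M ^ 4"] conjI ballI allI impI)
    show "M ^ 4 \<ge> 1" using M by (rule one_le_power)
    fix z u v assume z: "z \<in> hyp_plane"
      and uv: "twisted_metric b \<theta> z u u = 1 \<and> twisted_metric b \<theta> z v v = 1"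
    have l: "sqrt (hyp_factor z) > 0" using hyp_factor_pos[OF z] by simp
    have eq: "norm (beta b \<theta> z u) = norm (beta b \<theta> z v)"
      using uv speed[of \<theta> z u] speed[of \<theta> z v] l by (metis mult_left_cancel less_irrefl)
    have "norm (beta b (\<theta> + pi) z u) \<le> M * norm u" by (rule bounds(1)[OF z])
    also have "\<dots> \<le> M * (M * norm (beta b \<theta> z v))"
      using bounds(2)[OF z, of u \<theta>] M by (simp add: eq)
    also have "\<dots> \<le> M * (M * (M * norm v))"
      using bounds(1)[OF z, of \<theta> v] M by simp
    also have "\<dots> \<le> M * (M * (M * (M * norm (beta b (\<theta> + pi) z v))))"
      using bounds(2)[OF z, of v "\<theta> + pi"] M by simp
    finally have "norm (beta b (\<theta> + pi) z u) \<le> M ^ 4 * norm (beta b (\<theta> + pi) z v)"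
      by (simp add: power4_eq_xxxx mult.assoc)
    then show "sqrt (pullback_metric (\<lambda>z. z) (twisted_metric b (\<theta> + pi)) z u u)
        \<le> M ^ 4 * sqrt (pullback_metric (\<lambda>z. z) (twisted_metric b (\<theta> + pi)) z v v)"
      using l by (simp add: pullback_metric_def speed mult.left_commute)
  qed
  then show ?thesis using hyperbolic complete minimal_lagrangian_twisted by blast
qed

end
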